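(* Let $I$ be a non-empty set, $T=\{z\in\mathbb{C}:|z|=1\}$, and let $K\subseteq T^I$ be a compact set with $\lambda(K)>0$, where $\lambda$ is the product measure on $T^I$ of the normalised Lebesgue measures $\frac{d\theta}{2\pi}$ on each factor. Then $K$ is a set of uniqueness for $\tilde A(\overline{D}^I)$: any $f,g\in\tilde A(\overline{D}^I)$ which coincide on $K$ coincide on $\overline{D}^I$.
   Context: $\overline{D}=\{z\in\mathbb{C}:|z|\le1\}$, products carry the product topology, and $\lambda$ is the regular Borel probability product measure on $T^I$. $\tilde A(\overline{D})$ is the set of functions $h:\overline{D}\to\mathbb{C}\cup\{\infty\}$ such that either $h\equiv\infty$, or $h$ is continuous on $\overline{D}$ (into the Riemann sphere), $h(D)\subseteq\mathbb{C}$ and $h|_D$ is holomorphic, $D$ the open unit disc. $\tilde A(\overline{D}^I)$ is the set of all functions $f:\overline{D}^I\to\mathbb{C}\cup\{\infty\}$ that are continuous and such that for every $j_0\in I$ and every $z=(z_i)_{i\in I}\in\overline{D}^I$ the function $w\mapsto f(\zeta(w))$ belongs to $\tilde A(\overline{D})$, where $\zeta(w)_{j_0}=w$ and $\zeta(w)_j=z_j$ for $j\neq j_0$. *)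

theory Defs
  imports "HOL-Probability.Probability" "HOL-Complex_Analysis.Complex_Analysis"
begin

text \<open>The Riemann sphere \<open>\<complex> \<union> {\<infinity>}\<close> is represented by \<open>complex option\<close>,
  with \<open>None\<close> playing the role of \<open>\<infinity>\<close>.  Its topology is the one transported from
  the unit sphere of \<open>\<real>\<^sup>3\<close> by (inverse) stereographic projection.\<close>

definition riem :: "complex option \<Rightarrow> real \<times> real \<times> real" where
  "riem w = (case w of
      None \<Rightarrow> (0, 0, 1)
    | Some z \<Rightarrow> (2 * Re z / (cmod z ^ 2 + 1), 2 * Im z / (cmod z ^ 2 + 1),
                 (cmod z ^ 2 - 1) / (cmod z ^ 2 + 1)))"

definition A_disc :: "(complex \<Rightarrow> complex option) set" where
  "A_disc = {h. (\<forall>z\<in>cball 0 1. h z = None) \<or>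
       (continuous_on (cball 0 1) (riem \<circ> h) \<and>
        (\<forall>z\<in>ball 0 1. h z \<noteq> None) \<and>
        (\<lambda>z. the (h z)) holomorphic_on ball 0 1)}"

definition A_polydisc :: "'i set \<Rightarrow> (('i \<Rightarrow> complex) \<Rightarrow> complex option) set" where
  "A_polydisc I = {f.
      continuous_map (product_topology (\<lambda>_. top_of_set (cball 0 1)) I) euclidean (riem \<circ> f) \<and>
      (\<forall>j0\<in>I. \<forall>z\<in>PiE I (\<lambda>_. cball (0::complex) 1). (\<lambda>w. f (z(j0 := w))) \<in> A_disc)}"

definition circle_measure :: "complex measure" where
  "circle_measure = distr (uniform_measure lborel {0..2*pi}) borel cis"

definition torus_measure :: "'i set \<Rightarrow> ('i \<Rightarrow> complex) measure" where
  "torus_measure I = PiM I (\<lambda>_. circle_measure)"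

text \<open>Measure of a compact set under the regular Borel extension: equals the outer
  measure w.r.t. the (Baire = product) sigma-algebra.\<close>
definition torus_outer :: "'i set \<Rightarrow> ('i \<Rightarrow> complex) set \<Rightarrow> ennreal" where
  "torus_outer I K = (INF B \<in> {B \<in> sets (torus_measure I). K \<subseteq> B}. emeasure (torus_measure I) B)"

end

theory Submission
  imports Defs
begin

text \<open>
  One variable: if \<open>F\<close> is holomorphic on the disc with \<open>|F| \<le> 1\<close>, the maximum principle for
  products of rotated copies of \<open>F\<close> gives Jensen's inequality for \<open>ln (max |F| \<epsilon>)\<close>, and
  letting \<open>\<epsilon> \<rightarrow> 0\<close> shows that \<open>F 0 = 0\<close> as soon as the radial limits vanish on a set of positive
  measure.  Pulling back along an explicit conformal map onto a half-disc adjacent to a boundary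
  arc makes this local, so it applies to functions with values in the sphere, read in the charts
  \<open>w\<close> and \<open>1/w\<close>: two members of \<open>A_disc\<close> that differ somewhere differ almost everywhere on the
  circle.

  Several variables: fix \<open>x\<close> in the closed polydisc and a finite \<open>F \<subseteq> I\<close>, and consider the points
  that have the coordinates of \<open>x\<close> on \<open>F\<close> and those of a random point of the torus elsewhere.  By
  Fubini and the one-variable result, \<open>f\<close> and \<open>g\<close> agree at such a point with positive probability:
  this holds for \<open>F = {}\<close> because of \<open>K\<close>, and it is preserved when a coordinate is added to \<open>F\<close>.  As
  these points converge to \<open>x\<close> along the finite sets \<open>F\<close>, continuity yields \<open>f x = g x\<close>.
\<close>

subsection \<open>Vanishing radial limits\<close>

lemma integral_over_shifted_period:
  fixes q :: "real \<Rightarrow> real"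
  assumes cont: "continuous_on UNIV q" and per: "\<And>t. q (t + p) = q t" and t: "0 \<le> t" "t \<le> p"
  shows "integral {t..t + p} q = integral {0..p} q"
proof -
  have int: "q integrable_on {a..b}" for a b
    by (intro integrable_continuous_real continuous_on_subset[OF cont]) auto
  have "integral {p..p + t} q = integral {0..t} (\<lambda>x. q (x + p))"
    using integral_shift_real_ivl[of p p "p + t" q] by simp
  then have "integral {p..p + t} q = integral {0..t} q" by (simp add: per)
  moreover have "integral {t..p} q + integral {p..p + t} q = integral {t..p + t} q"
    using t by (intro Henstock_Kurzweil_Integration.integral_combine int) auto
  moreover have "integral {0..t} q + integral {t..p} q = integral {0..p} q"
    using t by (intro Henstock_Kurzweil_Integration.integral_combine int) auto
  ultimately show ?thesis by (simp add: add_ac)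
qed

text \<open>Integrate the constant \<open>q (node) - e\<close>, a lower bound for \<open>q\<close>,
  over each cell and add up. One-sided oscillation suffices because Jensen's inequality only asks
  for an upper bound of the sum.\<close>

lemma lower_Riemann_sum_le_integral:
  fixes q :: "real \<Rightarrow> real"
  assumes cont: "continuous_on UNIV q" and h: "0 \<le> h"
    and osc: "\<And>k x. k < n \<Longrightarrow> t + real k * h \<le> x \<Longrightarrow> x \<le> t + real (Suc k) * h \<Longrightarrow> q (t + real k * h) \<le> q x + e"
  shows "(\<Sum>k<n. h * (q (t + real k * h) - e)) \<le> integral {t..t + real n * h} q"
  using osc
proof (induction n)
  case 0
  then show ?case by simp
next
  case (Suc n)
  have int: "q integrable_on {a..b}" for a b
    by (intro integrable_continuous_real continuous_on_subset[OF cont]) auto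
  have "h * (q (t + real n * h) - e) = integral {t + real n * h..t + real (Suc n) * h} (\<lambda>x. q (t + real n * h) - e)"
    using h by (simp add: algebra_simps)
  also have "\<dots> \<le> integral {t + real n * h..t + real (Suc n) * h} q"
    using Suc.prems[of n] by (intro integral_le int) (auto simp: diff_le_eq)
  finally have "(\<Sum>k<Suc n. h * (q (t + real k * h) - e)) \<le>
      integral {t..t + real n * h} q + integral {t + real n * h..t + real (Suc n) * h} q"
    using Suc.IH Suc.prems by force
  also have "\<dots> = integral {t..t + real (Suc n) * h} q"
    using h by (intro Henstock_Kurzweil_Integration.integral_combine int) (auto simp: algebra_simps)
  finally show ?case .
qed

text \<open>Apply the maximum principle to a product of \<open>N\<close> rotated copies of
  \<open>F\<close>: its value at 0 is \<open>F 0 ^ N\<close>, and on the circle of radius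
  \<open>r\<close> its logarithm is at most a Riemann sum of the truncated logarithm. Truncation at
  \<epsilon> keeps the integrand continuous where \<open>F\<close> vanishes.\<close>

lemma Jensen_truncated:
  assumes holF: "F holomorphic_on ball 0 1" and r: "0 < r" "r < 1" and \<epsilon>: "0 < \<epsilon>" and nz: "F 0 \<noteq> 0"
  shows "2 * pi * ln (cmod (F 0)) \<le>
    integral {0..2*pi} (\<lambda>t. ln (max (cmod (F (of_real r * cis t))) \<epsilon>))"
proof -
  define q where "q t = ln (max (cmod (F (of_real r * cis t))) \<epsilon>)" for t
  have in_disc: "cmod z \<le> r \<Longrightarrow> z \<in> ball 0 1" for z using r by auto
  have contF: "continuous_on (ball 0 1) F"
    using holF holomorphic_on_imp_continuous_on by blast
  have cont: "continuous_on UNIV q"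
    unfolding q_def using \<epsilon> r
    by (intro continuous_on_ln continuous_on_max continuous_on_norm continuous_intros
        continuous_on_compose2[OF contF])
      (auto simp: norm_mult max_def)
  have per: "q (t + 2*pi) = q t" for t
    by (simp add: q_def flip: cis_mult)
  have "2 * pi * ln (cmod (F 0)) \<le> integral {0..2*pi} q + \<eta>" if "\<eta> > 0" for \<eta>
  proof -
    \<comment> \<open>An error of \<open>e\<close> per unit length adds up to \<eta> over a full
      period.\<close>
    define e where "e = \<eta> / (2*pi)"
    have e: "e > 0" using that by (simp add: e_def)
    \<comment> \<open>The Riemann sums start at an angle of at most 2 pi and run over one period, so
      all their cells lie below 4 pi.\<close>
    have "uniformly_continuous_on {0..4*pi} q"
      by (intro compact_uniformly_continuous continuous_on_subset[OF cont]) auto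
    then obtain d where d: "d > 0"
      "\<And>x y. x \<in> {0..4*pi} \<Longrightarrow> y \<in> {0..4*pi} \<Longrightarrow> dist y x < d \<Longrightarrow> dist (q y) (q x) < e"
      using e unfolding uniformly_continuous_on_def by blast
    obtain N :: nat where N: "2*pi/d < real N" using reals_Archimedean2 by blast
    have N0: "real N > 0" using N d(1) by (smt (verit) divide_pos_pos pi_gt_zero)
    define h where "h = 2*pi/real N"
    have h: "h > 0" "h < d" "real N * h = 2*pi"
      using N N0 d(1) by (auto simp: h_def field_simps)
    have riemann: "(\<Sum>k<N. q (t + real k * h)) \<le> real N * (integral {0..2*pi} q + \<eta>) / (2*pi)"
      if t: "0 \<le> t" "t \<le> 2*pi" for t
    proof -
      have "(\<Sum>k<N. h * (q (t + real k * h) - e)) \<le> integral {t..t + real N * h} q"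
      proof (rule lower_Riemann_sum_le_integral[OF cont])
        fix k x assume k: "k < N" and x: "t + real k * h \<le> x" "x \<le> t + real (Suc k) * h"
        have k0: "0 \<le> real k * h" using h by simp
        have "real (Suc k) * h \<le> real N * h" using k h by (intro mult_right_mono) auto
        then have x4: "0 \<le> x" "x \<le> 4*pi" using x t h k0 by linarith+
        then have "dist (q (t + real k * h)) (q x) < e"
          using x t h k0 x4 by (intro d(2)) (auto simp: dist_real_def algebra_simps)
        then show "q (t + real k * h) \<le> q x + e" by (simp add: dist_real_def)
      qed (use h in auto)
      also have "\<dots> = integral {0..2*pi} q"
        using integral_over_shifted_period[OF cont per, of t] t h by simp
      finally have "h * (\<Sum>k<N. q (t + real k * h)) - real N * h * e \<le> integral {0..2*pi} q"
        by (simp add: sum_subtractf right_diff_distrib sum_distrib_left)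
      moreover have "real N * h * e = \<eta>" by (simp add: h e_def)
      ultimately have "h * (\<Sum>k<N. q (t + real k * h)) \<le> integral {0..2*pi} q + \<eta>" by linarith
      then show ?thesis using N0 by (simp add: h_def field_simps)
    qed
    \<comment> \<open>Since \<open>h = 2*pi/N\<close>, the rotations are by the \<open>N\<close>-th
      roots of unity. At a point of argument \<open>t\<close> the factors sample \<open>F\<close> at
      the nodes of the Riemann sum starting at \<open>t\<close>.\<close>
    define P where "P z = (\<Prod>k<N. F (cis (real k * h) * z))" for z
    have "(\<lambda>z. F (cis a * z)) holomorphic_on ball 0 1" for a
      using holomorphic_on_compose_gen[OF _ holF, of "\<lambda>z. cis a * z" "ball 0 1"]
      by (simp add: o_def image_subset_iff norm_mult holomorphic_intros)
    then have holP: "P holomorphic_on ball 0 1"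
      unfolding P_def by (intro holomorphic_on_prod)
    have "cmod (P 0) \<le> exp (real N * (integral {0..2*pi} q + \<eta>) / (2*pi))"
    proof (rule maximum_modulus_frontier[where S = "cball 0 r" and f = P and \<xi> = 0])
      have *: "cball 0 r \<subseteq> (ball 0 1 :: complex set)" using in_disc by auto
      then have "ball 0 r \<subseteq> (ball 0 1 :: complex set)" by auto
      then show "P holomorphic_on interior (cball 0 r)" 
        using holomorphic_on_subset[OF holP] by auto
      show "continuous_on (closure (cball 0 r)) P"
        using continuous_on_subset[OF holomorphic_on_imp_continuous_on[OF holP]] * by auto
      fix z :: complex assume "z \<in> frontier (cball 0 r)"
      then have z: "cmod z = r" using r by simp
      define t where "t = Arg2pi z"
      have t: "0 \<le> t" "t \<le> 2*pi" "z = of_real r * cis t"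
        using Arg2pi[of z] z by (auto simp: t_def cis_conv_exp is_Arg_def)
      have "cmod (P z) = (\<Prod>k<N. cmod (F (of_real r * cis (t + real k * h))))"
        by (simp add: P_def t prod_norm mult_ac flip: cis_mult)
      also have "\<dots> \<le> (\<Prod>k<N. exp (q (t + real k * h)))"
        using \<epsilon> by (intro prod_mono) (auto simp: q_def less_max_iff_disj)
      also have "\<dots> = exp (\<Sum>k<N. q (t + real k * h))"
        by (simp add: exp_sum)
      finally show "cmod (P z) \<le> exp (real N * (integral {0..2*pi} q + \<eta>) / (2*pi))"
        using riemann[OF t(1,2)] by (meson exp_le_cancel_iff order_trans)
    qed (use r in auto)
    also have "cmod (P 0) = exp (real N * ln (cmod (F 0)))"
      using nz N0 by (simp add: P_def norm_power exp_of_nat_mult)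
    finally have "real N * (2 * pi * ln (cmod (F 0))) \<le> real N * (integral {0..2*pi} q + \<eta>)"
      by (simp add: field_simps)
    then show ?thesis using N0 by (simp only: mult_le_cancel_left_pos)
  qed
  then show ?thesis unfolding q_def by (rule field_le_epsilon)
qed

text \<open>Otherwise Jensen's inequality bounds \<open>2 * pi * ln (cmod (F 0))\<close> by the
  integral of the truncated logarithm. As this integrand is at most 0, only its part over
  \<open>E\<close> is kept, which tends to \<open>m * ln \<epsilon>\<close> as the radius tends to
  1. Letting \<epsilon> tend to 0 gives a contradiction.\<close>

lemma zero_radial_limits_imp_zero:
  assumes holF: "F holomorphic_on ball 0 1" and le1: "\<And>z. z \<in> ball 0 1 \<Longrightarrow> cmod (F z) \<le> 1"
    and E: "E \<in> lmeasurable" "E \<subseteq> {0..2*pi}" "\<not> negligible E"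
    and lim: "\<And>t. t \<in> E \<Longrightarrow> ((\<lambda>r. F (of_real r * cis t)) \<longlongrightarrow> 0) (at_left (1::real))"
  shows "F 0 = 0"
proof (rule ccontr)
  assume nz: "F 0 \<noteq> 0"
  define m where "m = measure lebesgue E"
  have m: "m > 0"
    using E negligible_iff_measure[of E] by (auto simp: m_def zero_less_measure_iff measure_nonneg less_le)
  \<comment> \<open>The shift by 2 puts every radius, including \<open>r 0\<close>, strictly between
    0 and 1.\<close>
  define r :: "nat \<Rightarrow> real" where "r n = 1 - 1 / real (n + 2)" for n
  have r: "0 < r n" "r n < 1" for n by (auto simp: r_def)
  have contF: "continuous_on (ball 0 1) F"
    using holF holomorphic_on_imp_continuous_on by blast
  have r_lim: "filterlim r (at_left 1) sequentially"
    unfolding r_def by real_asymp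
  have bound: "2 * pi * ln (cmod (F 0)) \<le> m * ln \<epsilon>" if \<epsilon>: "0 < \<epsilon>" "\<epsilon> < 1" for \<epsilon>
  proof -
    define q where "q n t = ln (max (cmod (F (of_real (r n) * cis t))) \<epsilon>)" for n t
    have in_disc: "of_real (r n) * cis t \<in> ball 0 1" for n t using r[of n] by (simp add: norm_mult)
    have q: "ln \<epsilon> \<le> q n t" "q n t \<le> 0" for n t
    proof -
      have "max (cmod (F (of_real (r n) * cis t))) \<epsilon> \<le> 1" using \<epsilon> le1[OF in_disc, of n t] by simp
      then show "q n t \<le> 0" using \<epsilon> by (simp add: q_def)
      show "ln \<epsilon> \<le> q n t" unfolding q_def using \<epsilon> by (intro ln_mono) auto
    qed
    have cont: "continuous_on A (q n)" for A n
      unfolding q_def using \<epsilon> in_disc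
      by (intro continuous_on_ln continuous_on_max continuous_on_norm continuous_intros
          continuous_on_compose2[OF contF]) (auto simp: max_def)
    have abs_int: "q n absolutely_integrable_on {0..2*pi}" for n
      by (intro absolutely_integrable_continuous_real cont)
    then have int: "q n integrable_on E" for n
      using set_integrable_subset[OF abs_int, of E] E
      by (auto intro: set_lebesgue_integral_eq_integral(1))
    have const: "((\<lambda>t. c) has_integral m * c) E" for c :: real
      using has_integral_mult_left[of "\<lambda>_. 1" m E c] E(1) lmeasure_integral[OF E(1)]
      by (simp add: lmeasurable_iff_integrable_on m_def has_integral_iff)
    have "(\<lambda>n. integral E (q n)) \<longlonglongrightarrow> integral E (\<lambda>t. ln \<epsilon>)"
    proof (rule dominated_convergence(2)[where h = "\<lambda>_. - ln \<epsilon>"])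
      show "(\<lambda>_. - ln \<epsilon>) integrable_on E" using const by blast
      show "norm (q n t) \<le> - ln \<epsilon>" for n t using q[of n t] by simp
      fix t assume "t \<in> E"
      from filterlim_compose[OF lim[OF this] r_lim]
      have "(\<lambda>n. q n t) \<longlonglongrightarrow> ln (max (cmod 0) \<epsilon>)"
        unfolding q_def using \<epsilon> by (intro tendsto_intros) (auto simp: max_def)
      then show "(\<lambda>n. q n t) \<longlonglongrightarrow> ln \<epsilon>" using \<epsilon> by (simp add: max_def)
    qed (fact int)
    then have "(\<lambda>n. integral E (q n)) \<longlonglongrightarrow> m * ln \<epsilon>"
      using integral_unique[OF const] by simp
    moreover have "2 * pi * ln (cmod (F 0)) \<le> integral E (q n)" for n
    proof -
      have "2 * pi * ln (cmod (F 0)) \<le> integral {0..2*pi} (q n)"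
        unfolding q_def using Jensen_truncated[OF holF r \<epsilon>(1) nz] .
      \<comment> \<open>Monotonicity in the domain holds for nonnegative integrands, hence the
        change of sign.\<close>
      also have "integral E (\<lambda>t. - q n t) \<le> integral {0..2*pi} (\<lambda>t. - q n t)"
        using q abs_int[of n] int[of n] E(2)
        by (intro integral_subset_le integrable_neg) (auto intro: set_lebesgue_integral_eq_integral(1))
      then have "integral {0..2*pi} (q n) \<le> integral E (q n)" by simp
      finally show ?thesis .
    qed
    ultimately show ?thesis by (intro LIMSEQ_le_const) auto
  qed
  \<comment> \<open>With \<open>\<epsilon> = exp (- x)\<close> the bound becomes
    \<open>a \<le> - (1 + \<bar>a\<bar>)\<close> for \<open>a = 2 * pi * ln (cmod (F 0))\<close>,
    which is absurd.\<close>
  define x where "x = (1 + \<bar>2 * pi * ln (cmod (F 0))\<bar>) / m"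
  have "x > 0" using m by (simp add: x_def)
  then have "2 * pi * ln (cmod (F 0)) \<le> m * ln (exp (- x))" by (intro bound) auto
  also have "\<dots> = - (1 + \<bar>2 * pi * ln (cmod (F 0))\<bar>)" using m by (simp add: x_def)
  finally show False by linarith
qed

subsection \<open>Localization at a boundary arc\<close>

text \<open>
  A Cayley map onto the upper half-plane, a square root onto the quadrant, and a fractional linear map onto
  the upper half-disc, which takes the boundary angles in \<open>(\<pi>, 2\<pi>)\<close> to the diameter \<open>(-1, 1)\<close>.
\<close>

definition half_disc_map :: "complex \<Rightarrow> complex" where
  "half_disc_map u = (csqrt (\<i> * (1 + u) / (1 - u)) - 1) / (csqrt (\<i> * (1 + u) / (1 - u)) + 1)"

abbreviation upper_half_disc :: "complex set" where
  "upper_half_disc \<equiv> {w. cmod w < 1 \<and> 0 < Im w}"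

text \<open>The imaginary part equals (1 - |u|^2) / |1 - u|^2.\<close>

lemma Im_Cayley_pos:
  assumes "cmod u < 1"
  shows "0 < Im (\<i> * (1 + u) / (1 - u))"
proof -
  have "(Re u)\<^sup>2 + (Im u)\<^sup>2 < 1"
    using assms by (simp add: cmod_def)
  moreover have "u \<noteq> 1" using assms by auto
  then have "(1 - Re u)\<^sup>2 + (Im u)\<^sup>2 > 0"
    by (auto simp: complex_eq_iff sum_power2_gt_zero_iff)
  moreover have "Im (\<i> * (1 + u)) * Re (1 - u) - Re (\<i> * (1 + u)) * Im (1 - u) = 1 - ((Re u)\<^sup>2 + (Im u)\<^sup>2)"
    by (simp add: power2_eq_square algebra_simps)
  ultimately show ?thesis
    unfolding Im_divide by (intro divide_pos_pos) auto
qed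

text \<open>\<open>Im v = 2 * Re s * Im s\<close> makes both parts of the root \<open>s\<close>
  nonzero and of equal sign; the principal branch selects the positive one.\<close>

lemma csqrt_upper_half_plane:
  assumes "0 < Im v"
  shows "0 < Re (csqrt v)" "0 < Im (csqrt v)"
proof -
  define s where "s = csqrt v"
  have "Im v = 2 * Re s * Im s" unfolding s_def by (metis Im_power2 power2_csqrt)
  moreover have "0 < Re s \<or> Re s = 0 \<and> 0 \<le> Im s" unfolding s_def by (rule csqrt_principal)
  ultimately have "0 < Re s \<and> 0 < Im s" using assms by (auto simp: zero_less_mult_iff)
  then show "0 < Re (csqrt v)" "0 < Im (csqrt v)" by (simp_all only: s_def)
qed

text \<open>A point \<open>s\<close> of the open first quadrant is closer to 1 than to -1, and the
  imaginary part of (s - 1) / (s + 1) is 2 Im s / |s + 1|^2.\<close>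

lemma half_disc_map_in_half_disc:
  assumes "cmod u < 1"
  shows "half_disc_map u \<in> upper_half_disc"
proof -
  define s where "s = csqrt (\<i> * (1 + u) / (1 - u))"
  have s: "0 < Re s" "0 < Im s"
    using csqrt_upper_half_plane[OF Im_Cayley_pos[OF assms]] by (auto simp: s_def)
  then have s1: "s + 1 \<noteq> 0" by (auto simp: complex_eq_iff)
  have "(cmod (s - 1))\<^sup>2 < (cmod (s + 1))\<^sup>2"
    using s by (simp only: cmod_power2) (simp add: power2_eq_square algebra_simps)
  then have "cmod (s - 1) < cmod (s + 1)" by (rule power2_less_imp_less) simp
  then have "cmod ((s - 1) / (s + 1)) < 1" using s1 by (simp add: norm_divide)
  moreover have "(Re s + 1)\<^sup>2 + (Im s)\<^sup>2 > 0" using s by (simp add: sum_power2_gt_zero_iff)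
  then have "0 < Im ((s - 1) / (s + 1))"
    unfolding Im_divide using s by (intro divide_pos_pos) (auto simp: algebra_simps)
  ultimately show ?thesis by (simp add: half_disc_map_def s_def)
qed

lemma half_disc_map_holomorphic: "half_disc_map holomorphic_on ball 0 1"
proof -
  have *: "\<i> * (1 + u) / (1 - u) \<notin> \<real>\<^sub>\<le>\<^sub>0" "csqrt (\<i> * (1 + u) / (1 - u)) + 1 \<noteq> 0"
    if "u \<in> ball 0 1" for u
    using Im_Cayley_pos[of u] csqrt_upper_half_plane[OF Im_Cayley_pos[of u]] that
    by (auto simp: complex_nonpos_Reals_iff complex_eq_iff simp del: times_divide_eq_right)
  have "1 - u \<noteq> 0" if "u \<in> ball 0 1" for u :: complex using that by auto
  moreover have "(\<lambda>u. \<i> * (1 + u) / (1 - u)) holomorphic_on ball 0 1"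
    using calculation by (intro holomorphic_intros) auto
  then have "(\<lambda>u. csqrt (\<i> * (1 + u) / (1 - u))) holomorphic_on ball 0 1"
    using *(1) by (rule holomorphic_on_csqrt')
  then show ?thesis unfolding half_disc_map_def using *(2)
    by (intro holomorphic_on_divide holomorphic_on_diff holomorphic_on_add holomorphic_on_const)
qed

text \<open>The centre of the disc is where \<open>zero_radial_limits_imp_zero\<close> yields a
  zero, so its image is where the half-disc version will yield one.\<close>

lemma half_disc_map_0: "half_disc_map 0 = \<i> * of_real (sqrt 2 - 1)"
proof -
  define s where "s = Complex (1 / sqrt 2) (1 / sqrt 2)"
  have "csqrt \<i> = s"
    by (rule csqrt_unique) (auto simp: s_def complex_eq_iff Re_power2 Im_power2 power2_eq_square)
  moreover have "s - 1 = \<i> * of_real (sqrt 2 - 1) * (s + 1)"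
    by (auto simp: s_def complex_eq_iff field_simps)
  moreover have "s + 1 \<noteq> 0"
    by (auto simp: s_def complex_eq_iff)
  ultimately show ?thesis
    by (simp add: half_disc_map_def)
qed

text \<open>\<open>cis (2 * arctan y)\<close> is (1 + iy) / (1 - iy), so the point with angle
  \<open>pi + 2 * arctan y\<close> is (y - i) / (y + i), the preimage of \<open>y\<close> under the
  Cayley map.\<close>

lemma Cayley_boundary:
  assumes "0 < y"
  shows "cis (pi + 2 * arctan y) \<noteq> 1"
    and "\<i> * (1 + cis (pi + 2 * arctan y)) / (1 - cis (pi + 2 * arctan y)) = of_real y"
proof -
  have "cis (arctan y) = of_real (cos (arctan y)) * (1 + \<i> * of_real y)"
    using cos_arctan_not_zero[of y] tan_arctan[of y]
    by (auto simp: complex_eq_iff tan_def field_simps)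
  then have "cis (2 * arctan y) = of_real ((cos (arctan y))\<^sup>2) * (1 + \<i> * of_real y)\<^sup>2"
    using Complex.DeMoivre[of "arctan y" 2] by (simp add: power_mult_distrib)
  then have "cis (pi + 2 * arctan y) = - of_real (1 / (1 + y\<^sup>2)) * (1 + \<i> * of_real y)\<^sup>2"
    by (simp add: cis_mult[symmetric] cos_arctan power_divide)
  moreover have "of_real (1 / (1 + y\<^sup>2)) * (1 + \<i> * of_real y)\<^sup>2 = (\<i> - of_real y) / (\<i> + of_real y)"
  proof -
    have "\<i> + of_real y \<noteq> 0" "1 + y\<^sup>2 \<noteq> 0" by (auto simp: complex_eq_iff add_nonneg_eq_0_iff)
    moreover have "(1 + \<i> * of_real y)\<^sup>2 * (\<i> + of_real y) = (\<i> - of_real y) * of_real (1 + y\<^sup>2)"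
      by (auto simp: complex_eq_iff power2_eq_square algebra_simps)
    ultimately show ?thesis by (simp add: field_simps del: of_real_add)
  qed
  ultimately have "cis (pi + 2 * arctan y) = - ((\<i> - of_real y) / (\<i> + of_real y))" by simp
  then have u: "cis (pi + 2 * arctan y) = (of_real y - \<i>) / (of_real y + \<i>)"
    by (metis minus_diff_eq minus_divide_left add.commute)
  have ne: "of_real y + \<i> \<noteq> 0" by (auto simp: complex_eq_iff)
  show "cis (pi + 2 * arctan y) \<noteq> 1" unfolding u using ne by (auto simp: field_simps)
  have "1 + cis (pi + 2 * arctan y) = 2 * of_real y / (of_real y + \<i>)"
    "1 - cis (pi + 2 * arctan y) = 2 * \<i> / (of_real y + \<i>)"
    unfolding u using ne by (auto simp: field_simps)
  then show "\<i> * (1 + cis (pi + 2 * arctan y)) / (1 - cis (pi + 2 * arctan y)) = of_real y"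
    using ne by (simp only:) simp
qed

text \<open>Inverting the three factors in turn: \<open>s = (1 + x) / (1 - x)\<close> solves (s - 1)
  / (s + 1) = x, its square undoes the root, and \<open>Cayley_boundary\<close> gives the angle. The
  positive number \<open>s\<^sup>2\<close> avoids the branch cut, whence continuity.\<close>

lemma half_disc_map_boundary:
  fixes x :: real
  assumes "-1 < x" "x < 1"
  defines "u \<equiv> cis (pi + 2 * arctan (((1 + x) / (1 - x))\<^sup>2))"
  shows "half_disc_map u = of_real x" "isCont half_disc_map u"
proof -
  define s where "s = (1 + x) / (1 - x)"
  have s: "s > 0" using assms by (simp add: s_def)
  have u: "u \<noteq> 1" "\<i> * (1 + u) / (1 - u) = of_real (s\<^sup>2)"
    unfolding u_def s_def[symmetric] using Cayley_boundary[of "s\<^sup>2"] s by auto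
  have root: "csqrt (\<i> * (1 + u) / (1 - u)) = of_real s"
    unfolding u(2) using s by (intro csqrt_unique) auto
  have ne: "of_real s + (1::complex) \<noteq> 0" using s by (auto simp: complex_eq_iff)
  have "half_disc_map u = of_real ((s - 1) / (s + 1))"
    unfolding half_disc_map_def root by simp
  also have "(s - 1) / (s + 1) = x"
    using assms s by (simp add: s_def field_simps)
  finally show "half_disc_map u = of_real x" .
  have "\<i> * (1 + u) / (1 - u) \<notin> \<real>\<^sub>\<le>\<^sub>0"
    unfolding u(2) using s by (auto simp: complex_nonpos_Reals_iff)
  moreover have "csqrt (\<i> * (1 + u) / (1 - u)) + 1 \<noteq> 0" unfolding root by (fact ne)
  moreover have "1 - u \<noteq> 0" using u by auto
  ultimately show "isCont half_disc_map u"
    unfolding half_disc_map_def by (intro continuous_intros isCont_csqrt') auto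
qed

text \<open>Compose \<open>G\<close> with \<open>half_disc_map\<close> and apply
  \<open>zero_radial_limits_imp_zero\<close>. The set of angles lying over \<open>E\<close> is not
  null, since a differentiable map takes it back to \<open>E\<close>.\<close>

lemma zero_boundary_values_half_disc:
  assumes holG: "G holomorphic_on upper_half_disc"
    and le1: "\<And>w. w \<in> upper_half_disc \<Longrightarrow> cmod (G w) \<le> 1"
    and E: "compact E" "E \<subseteq> {-1<..<1}" "\<not> negligible E"
    and lim: "\<And>x. x \<in> E \<Longrightarrow> (G \<longlongrightarrow> 0) (at (of_real x) within upper_half_disc)"
  shows "G (\<i> * of_real (sqrt 2 - 1)) = 0"
proof -
  \<comment> \<open>\<open>\<tau> x\<close> is the boundary angle sent to \<open>x\<close>. In its
    inverse \<psi>, the tangent recovers the square of (1 + x) / (1 - x).\<close>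
  define \<tau> where "\<tau> x = pi + 2 * arctan (((1 + x) / (1 - x))\<^sup>2)" for x :: real
  define \<psi> where "\<psi> t = (sqrt (tan (t / 2 - pi / 2)) - 1) / (sqrt (tan (t / 2 - pi / 2)) + 1)" for t :: real
  have \<tau>: "\<tau> x / 2 - pi / 2 = arctan (((1 + x) / (1 - x))\<^sup>2)" for x
    by (simp add: \<tau>_def add_divide_distrib)
  have inv: "\<psi> (\<tau> x) = x" if "x \<in> E" for x
  proof -
    define s where "s = (1 + x) / (1 - x)"
    have x: "-1 < x" "x < 1" using that E by auto
    have s: "s > 0" using x by (simp add: s_def)
    have "\<psi> (\<tau> x) = (s - 1) / (s + 1)"
      unfolding \<psi>_def \<tau> tan_arctan s_def[symmetric] using s by simp
    also have "\<dots> = x" using x s by (simp add: s_def field_simps)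
    finally show ?thesis .
  qed
  have diff: "\<psi> differentiable_on \<tau> ` E"
  proof (intro differentiable_at_imp_differentiable_on)
    fix t assume "t \<in> \<tau> ` E"
    then obtain x where x: "x \<in> E" "t = \<tau> x" by blast
    define s where "s = (1 + x) / (1 - x)"
    have s: "s > 0" using x E by (auto simp: s_def)
    have angle: "t / 2 - pi / 2 = arctan (s\<^sup>2)" by (simp add: x(2) \<tau> s_def)
    have tan: "((\<lambda>t. tan (t / 2 - pi / 2)) has_real_derivative
        inverse ((cos (t / 2 - pi / 2))\<^sup>2) * (1 / 2)) (at t)"
      by (rule DERIV_chain2[OF DERIV_tan])
        (auto simp: angle cos_arctan_not_zero intro!: derivative_eq_intros)
    have "0 < tan (t / 2 - pi / 2)" using s by (simp add: angle tan_arctan)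
    from DERIV_chain2[OF DERIV_real_sqrt[OF this] tan]
    have root: "((\<lambda>t. sqrt (tan (t / 2 - pi / 2))) has_real_derivative
        inverse (sqrt (tan (t / 2 - pi / 2))) / 2 * (inverse ((cos (t / 2 - pi / 2))\<^sup>2) * (1 / 2))) (at t)" .
    have "sqrt (tan (t / 2 - pi / 2)) + 1 \<noteq> 0" using s by (simp add: angle tan_arctan)
    from DERIV_divide[OF DERIV_diff[OF root DERIV_const[of 1]] DERIV_add[OF root DERIV_const[of 1]] this]
    have "\<exists>D. (\<psi> has_real_derivative D) (at t)" unfolding \<psi>_def by blast
    then show "\<psi> differentiable at t" by (metis real_differentiable_def)
  qed
  have "continuous_on E \<tau>"
    unfolding \<tau>_def using E by (intro continuous_intros) auto
  then have comp: "compact (\<tau> ` E)" using E(1) compact_continuous_image by blast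
  have neg: "\<not> negligible (\<tau> ` E)"
  proof
    assume "negligible (\<tau> ` E)"
    from negligible_differentiable_image_negligible[OF order_refl this diff]
    have "negligible (\<psi> ` \<tau> ` E)" .
    moreover have "\<psi> ` \<tau> ` E = E" using inv by (force simp: image_image)
    ultimately show False using E by simp
  qed
  have "(G \<circ> half_disc_map) 0 = 0"
  proof (rule zero_radial_limits_imp_zero[OF _ _ _ _ neg])
    show "(G \<circ> half_disc_map) holomorphic_on ball 0 1"
      using half_disc_map_in_half_disc
      by (intro holomorphic_on_compose_gen[OF half_disc_map_holomorphic holG]) auto
    show "cmod ((G \<circ> half_disc_map) z) \<le> 1" if "z \<in> ball 0 1" for z
      using le1[OF half_disc_map_in_half_disc] that by simp
    show "\<tau> ` E \<in> lmeasurable" using comp by (rule lmeasurable_compact)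
    show "\<tau> ` E \<subseteq> {0..2*pi}"
      using arctan_lbound arctan_ubound 
      by (auto simp: \<tau>_def) (smt (verit) arctan_lbound arctan_ubound field_sum_of_halves)+
    fix t assume "t \<in> \<tau> ` E"
    then obtain x where x: "x \<in> E" "t = \<tau> x" by blast
    then have x1: "-1 < x" "x < 1" using E by auto
    have "((\<lambda>r. of_real r * cis t) \<longlongrightarrow> of_real 1 * cis t) (at_left (1::real))"
      by (intro tendsto_intros)
    then have "((\<lambda>r. half_disc_map (of_real r * cis t)) \<longlongrightarrow> of_real x) (at_left (1::real))"
      using isCont_tendsto_compose[OF half_disc_map_boundary(2)[OF x1]]
      unfolding x(2) \<tau>_def half_disc_map_boundary(1)[OF x1] by simp
    moreover have "eventually (\<lambda>r. r \<in> {0<..<1}) (at_left (1::real))"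
      using eventually_at_left_real by force
    then have "eventually (\<lambda>r. half_disc_map (of_real r * cis t) \<in> upper_half_disc) (at_left (1::real))"
      by eventually_elim (rule half_disc_map_in_half_disc, simp add: norm_mult)
    then have "eventually (\<lambda>r. half_disc_map (of_real r * cis t) \<in> upper_half_disc \<and>
        half_disc_map (of_real r * cis t) \<noteq> of_real x) (at_left (1::real))"
      by eventually_elim auto
    ultimately have "filterlim (\<lambda>r. half_disc_map (of_real r * cis t))
       (at (of_real x) within upper_half_disc) (at_left (1::real))"
      by (simp add: filterlim_at)
    from filterlim_compose[OF lim[OF x(1)] this]
    show "((\<lambda>r. (G \<circ> half_disc_map) (of_real r * cis t)) \<longlongrightarrow> 0) (at_left (1::real))"
      by simp
  qed
  then show ?thesis by (simp add: half_disc_map_0)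
qed

text \<open>In an exponential coordinate the arc around \<open>cis t\<^sub>0\<close> becomes a real
  interval. If \<open>S\<close> were not null there, the half-disc lemma would give a zero of
  \<open>G\<close> for each radius in an interval; these zeros accumulate in the connected set
  \<Omega>, so \<open>G\<close> would vanish at \<open>z\<^sub>0\<close>.\<close>

lemma local_boundary_uniqueness:
  fixes t\<^sub>0 r :: real and S :: "real set"
  defines "\<Omega> \<equiv> ball 0 1 \<inter> ball (cis t\<^sub>0) r"
  assumes r: "0 < r" and holG: "G holomorphic_on \<Omega>"
    and bound: "\<And>z. z \<in> \<Omega> \<Longrightarrow> cmod (G z) \<le> B"
    and S: "closed S"
    and lim: "\<And>t. t \<in> S \<Longrightarrow> cis t \<in> ball (cis t\<^sub>0) r \<Longrightarrow> (G \<longlongrightarrow> 0) (at (cis t) within \<Omega>)"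
    and nz: "z\<^sub>0 \<in> \<Omega>" "G z\<^sub>0 \<noteq> 0"
  obtains \<delta> where "0 < \<delta>" "negligible (S \<inter> {t\<^sub>0 - \<delta>..t\<^sub>0 + \<delta>})"
proof -
  \<comment> \<open>\<open>e\<close> maps the real line to the circle, the upper half-plane into the
    unit disc, and 0 to \<open>cis t\<^sub>0\<close>.\<close>
  define e where "e w = exp (\<i> * (of_real t\<^sub>0 + w))" for w :: complex
  have e_norm: "cmod (e w) = exp (- Im w)" for w by (simp add: e_def)
  have e_real: "e (of_real x) = cis (t\<^sub>0 + x)" for x by (simp add: e_def cis_conv_exp)
  have e_cont: "isCont e w" for w unfolding e_def by (intro continuous_intros)
  have "eventually (\<lambda>w. e w \<in> ball (cis t\<^sub>0) r) (nhds 0)"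
    using e_cont[of 0] r e_real[of 0]
    by (intro topological_tendstoD[of e "cis t\<^sub>0"]) (auto simp: continuous_at tendsto_at_iff_tendsto_nhds)
  then obtain d where d: "d > 0" "\<And>w. cmod w < d \<Longrightarrow> e w \<in> ball (cis t\<^sub>0) r"
    by (auto simp: eventually_nhds_metric dist_norm)
  have e_in: "e w \<in> \<Omega>" if "cmod w < d" "0 < Im w" for w
    using d(2)[OF that(1)] that(2) by (simp add: \<Omega>_def e_norm)
  define \<kappa> where "\<kappa> = sqrt 2 - 1"
  have \<kappa>: "0 < \<kappa>" "\<kappa> < 1" using real_less_lsqrt[of 2 2] by (auto simp: \<kappa>_def)
  define B' where "B' = max B 1"
  have "B' > 0" by (simp add: B'_def)
  \<comment> \<open>Half of \<open>d\<close> leaves room for the radii: each \<rho> between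
    \<open>d/2\<close> and \<open>d\<close> has the whole interval strictly inside its diameter, and
    its half-disc is still mapped into \<Omega>.\<close>
  have "negligible (S \<inter> {t\<^sub>0 - d/2..t\<^sub>0 + d/2})"
  proof (rule ccontr)
    assume nonnull: "\<not> negligible (S \<inter> {t\<^sub>0 - d/2..t\<^sub>0 + d/2})"
    \<comment> \<open>Half-discs of varying radius \<open>\<rho>\<close> produce a whole segment of zeros.\<close>
    have zero: "G (e (\<i> * of_real (\<rho> * \<kappa>))) = 0" if \<rho>: "\<rho> \<in> {d/2<..<d}" for \<rho>
    proof -
      define E where "E = (\<lambda>t. (t - t\<^sub>0) / \<rho>) ` (S \<inter> {t\<^sub>0 - d/2..t\<^sub>0 + d/2})"
      have \<rho>0: "\<rho> > 0" using \<rho> d(1) by simp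
      have scaled: "cmod (of_real \<rho> * w) < d" if "cmod w < 1" for w
      proof -
        have "\<rho> * cmod w \<le> \<rho> * 1" using that \<rho>0 by (intro mult_left_mono) auto
        then have "\<rho> * cmod w < d" using \<rho> unfolding mult_1_right greaterThanLessThan_iff by linarith
        then show ?thesis using \<rho>0 by (simp add: norm_mult)
      qed
      have in_\<Omega>: "e (of_real \<rho> * w) \<in> \<Omega>" if "w \<in> upper_half_disc" for w
        using that \<rho>0 scaled by (intro e_in) auto
      have "(\<lambda>w. G (e (of_real \<rho> * w)) / of_real B') (\<i> * of_real (sqrt 2 - 1)) = 0"
      proof (rule zero_boundary_values_half_disc[where E = E])
        have "(\<lambda>w. e (of_real \<rho> * w)) holomorphic_on upper_half_disc"
          unfolding e_def by (intro holomorphic_intros)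
        then have "(\<lambda>w. G (e (of_real \<rho> * w))) holomorphic_on upper_half_disc"
          using holomorphic_on_compose_gen[OF _ holG] in_\<Omega> by (simp add: o_def image_subset_iff)
        then show "(\<lambda>w. G (e (of_real \<rho> * w)) / of_real B') holomorphic_on upper_half_disc"
          using \<open>B' > 0\<close> by (intro holomorphic_intros) auto
        show "cmod (G (e (of_real \<rho> * w)) / of_real B') \<le> 1" if "w \<in> upper_half_disc" for w
          using bound[OF in_\<Omega>[OF that]] \<open>B' > 0\<close> by (simp add: norm_divide B'_def)
        have "compact (S \<inter> {t\<^sub>0 - d/2..t\<^sub>0 + d/2})"
          using S by (simp add: closed_Int_compact)
        then show "compact E" unfolding E_def
          using \<rho>0 by (intro compact_continuous_image continuous_intros) auto
        show "E \<subseteq> {-1<..<1}"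
          using \<rho> \<rho>0 by (auto simp: E_def field_simps)
        show "\<not> negligible E"
        proof
          assume "negligible E"
          then have "negligible ((\<lambda>x. t\<^sub>0 + \<rho> * x) ` E)"
            by (intro negligible_differentiable_image_negligible derivative_intros
                differentiable_at_imp_differentiable_on) auto
          moreover have "(\<lambda>x. t\<^sub>0 + \<rho> * x) ` E = S \<inter> {t\<^sub>0 - d/2..t\<^sub>0 + d/2}"
            using \<rho>0 by (force simp: E_def image_image)
          ultimately show False using nonnull by simp
        qed
        fix x assume "x \<in> E"
        then have x: "t\<^sub>0 + \<rho> * x \<in> S" "\<bar>x\<bar> < 1"
          using \<rho> \<rho>0 by (auto simp: E_def field_simps)
        have e_x: "e (of_real \<rho> * of_real x) = cis (t\<^sub>0 + \<rho> * x)"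
          using e_real[of "\<rho> * x"] by simp
        then have "cis (t\<^sub>0 + \<rho> * x) \<in> ball (cis t\<^sub>0) r"
          using d(2)[OF scaled[of "of_real x"]] x(2) by simp
        note lim = lim[OF x(1) this]
        have "((\<lambda>w. e (of_real \<rho> * w)) \<longlongrightarrow> e (of_real \<rho> * of_real x)) (at (of_real x) within upper_half_disc)"
          unfolding e_def by (intro tendsto_intros)
        moreover have "eventually (\<lambda>w. w \<in> upper_half_disc) (at (of_real x) within upper_half_disc)"
          by (simp add: eventually_at_filter)
        then have "eventually (\<lambda>w. e (of_real \<rho> * w) \<in> \<Omega> \<and> e (of_real \<rho> * w) \<noteq> cis (t\<^sub>0 + \<rho> * x))
            (at (of_real x) within upper_half_disc)"
        proof eventually_elim
          fix w assume "w \<in> upper_half_disc"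
          from in_\<Omega>[OF this] have "e (of_real \<rho> * w) \<in> \<Omega>" "cmod (e (of_real \<rho> * w)) < 1"
            by (auto simp: \<Omega>_def)
          then show "e (of_real \<rho> * w) \<in> \<Omega> \<and> e (of_real \<rho> * w) \<noteq> cis (t\<^sub>0 + \<rho> * x)"
            by auto
        qed
        ultimately have "filterlim (\<lambda>w. e (of_real \<rho> * w)) (at (cis (t\<^sub>0 + \<rho> * x)) within \<Omega>)
            (at (of_real x) within upper_half_disc)"
          unfolding e_x by (simp add: filterlim_at)
        from filterlim_compose[OF lim this]
        have "((\<lambda>w. G (e (of_real \<rho> * w)) / of_real B') \<longlongrightarrow> 0 / of_real B') (at (of_real x) within upper_half_disc)"
          using \<open>B' > 0\<close> by (intro tendsto_intros) auto
        then show "((\<lambda>w. G (e (of_real \<rho> * w)) / of_real B') \<longlongrightarrow> 0) (at (of_real x) within upper_half_disc)"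
          by simp
      qed
      then show ?thesis using \<open>B' > 0\<close> by (simp add: \<kappa>_def mult_ac)
    qed
    define U where "U = (\<lambda>\<rho>. e (\<i> * of_real (\<rho> * \<kappa>))) ` {d/2<..<d}"
    have U_sub: "U \<subseteq> \<Omega>"
    proof -
      have "\<rho> * \<kappa> < d" "0 < \<rho> * \<kappa>" if "\<rho> \<in> {d/2<..<d}" for \<rho>
      proof -
        have "0 < \<rho>" "\<rho> < d" using that d(1) by auto
        then have "\<rho> * \<kappa> < \<rho> * 1" using \<kappa> by (intro mult_strict_left_mono)
        then show "\<rho> * \<kappa> < d" using \<open>\<rho> < d\<close> by linarith
        show "0 < \<rho> * \<kappa>" using \<kappa> \<open>0 < \<rho>\<close> by simp
      qed
      then have "e (\<i> * of_real (\<rho> * \<kappa>)) \<in> \<Omega>" if "\<rho> \<in> {d/2<..<d}" for \<rho>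
        using that abs_of_pos[of "\<rho> * \<kappa>"] by (intro e_in) (simp_all add: norm_mult abs_mult)
      then show ?thesis unfolding U_def by blast
    qed
    have "G z\<^sub>0 = 0"
    proof (rule analytic_continuation[OF holG _ _ U_sub])
      show "open \<Omega>" "connected \<Omega>"
        by (auto simp: \<Omega>_def intro!: convex_connected convex_Int)
      define \<xi> where "\<xi> \<rho> = e (\<i> * of_real (\<rho> * \<kappa>))" for \<rho>
      have U: "U = \<xi> ` {d/2<..<d}" by (auto simp: U_def \<xi>_def)
      have norm_\<xi>: "cmod (\<xi> \<rho>) = exp (- (\<rho> * \<kappa>))" for \<rho> by (simp add: \<xi>_def e_norm)
      have "connected U"
        unfolding U \<xi>_def e_def
        by (intro connected_continuous_image continuous_intros) auto
      \<comment> \<open>Two points of different modulus show that the connected set \<open>U\<close>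
        is not a singleton, so each of its points is a limit point.\<close>
      moreover have in_U: "\<xi> (3/4*d) \<in> U" "\<xi> (2/3*d) \<in> U" using d(1) by (auto simp: U)
      moreover have "cmod (\<xi> (3/4*d)) \<noteq> cmod (\<xi> (2/3*d))" using \<kappa> d(1) by (simp add: norm_\<xi>)
      then have "U \<noteq> {x}" for x using in_U by auto
      ultimately show "\<xi> (3/4*d) islimpt U" by (intro connected_imp_perfect) auto
      show "\<xi> (3/4*d) \<in> \<Omega>" using in_U U_sub by auto
      show "G z = 0" if "z \<in> U" for z using that zero by (auto simp: U_def)
    qed (fact nz)
    then show False using nz by simp
  qed
  then show ?thesis using that[of "d/2"] d(1) by simp
qed

subsection \<open>Sphere-valued functions of one variable\<close>

lemma riem_Some_third: "snd (snd (riem (Some z))) = 1 - 2 / ((cmod z)\<^sup>2 + 1)"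
proof -
  have "(cmod z)\<^sup>2 + 1 \<noteq> 0" using zero_le_power2[of "cmod z"] by linarith
  then show ?thesis by (simp add: riem_def field_simps)
qed

text \<open>Stereographic projection from the north pole, which represents infinity.\<close>

definition affine_chart :: "real \<times> real \<times> real \<Rightarrow> complex" where
  "affine_chart p = Complex (fst p) (fst (snd p)) / of_real (1 - snd (snd p))"

text \<open>Stereographic projection from the south pole followed by conjugation, which makes it
  read the coordinate 1/w.\<close>

definition inverse_chart :: "real \<times> real \<times> real \<Rightarrow> complex" where
  "inverse_chart p = Complex (fst p) (- fst (snd p)) / of_real (1 + snd (snd p))"

lemma affine_chart_riem: "affine_chart (riem (Some z)) = z"
proof -
  have "(cmod z)\<^sup>2 + 1 \<noteq> 0" using zero_le_power2[of "cmod z"] by linarith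
  then show ?thesis
    by (simp add: affine_chart_def riem_Some_third)
      (auto simp: riem_def complex_eq_iff)
qed

text \<open>The case \<open>z = 0\<close> is covered by convention: the chart then is 0 divided by
  0, and \<open>inverse 0 = 0\<close>.\<close>

lemma inverse_chart_riem: "inverse_chart (riem (Some z)) = inverse z"
proof (cases "z = 0")
  case True
  then show ?thesis by (simp add: inverse_chart_def riem_def Complex_eq_0)
next
  case False
  have n: "(cmod z)\<^sup>2 + 1 \<noteq> 0" using zero_le_power2[of "cmod z"] by linarith
  then have "1 + snd (snd (riem (Some z))) = 2 * (cmod z)\<^sup>2 / ((cmod z)\<^sup>2 + 1)"
    by (simp add: riem_Some_third field_simps)
  then have "inverse_chart (riem (Some z)) = of_real (2 / ((cmod z)\<^sup>2 + 1)) * cnj z /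
      of_real (2 * (cmod z)\<^sup>2 / ((cmod z)\<^sup>2 + 1))"
    by (simp only: inverse_chart_def) (auto simp: riem_def complex_eq_iff)
  also have "\<dots> = cnj z / of_real ((cmod z)\<^sup>2)"
  proof -
    have "of_real x * c / of_real y = of_real (x / y) * c" for x y :: real and c :: complex by simp
    moreover have "2 / ((cmod z)\<^sup>2 + 1) / (2 * (cmod z)\<^sup>2 / ((cmod z)\<^sup>2 + 1)) = 1 / (cmod z)\<^sup>2"
      using n by (simp add: divide_divide_eq_left divide_divide_eq_right del: add_mult_distrib2 distrib_left_numeral)
    ultimately have "of_real (2 / ((cmod z)\<^sup>2 + 1)) * cnj z / of_real (2 * (cmod z)\<^sup>2 / ((cmod z)\<^sup>2 + 1)) =
        of_real (1 / (cmod z)\<^sup>2) * cnj z" by (simp only:)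
    then show ?thesis by simp
  qed
  also have "\<dots> = inverse z" using False by (simp add: inverse_eq_divide complex_div_cnj[of 1 z])
  finally show ?thesis .
qed

lemma inverse_chart_infinity: "inverse_chart (riem None) = 0"
  by (simp add: inverse_chart_def riem_def Complex_eq_0)

lemma riem_third_less_1_iff: "snd (snd (riem w)) < 1 \<longleftrightarrow> w \<noteq> None"
proof (cases w)
  case (Some z)
  have "(cmod z)\<^sup>2 + 1 > 0" using zero_le_power2[of "cmod z"] by linarith
  then show ?thesis by (simp add: Some riem_Some_third)
qed (simp add: riem_def)

lemma riem_third_greater_minus_1_iff: "-1 < snd (snd (riem w)) \<longleftrightarrow> w \<noteq> Some 0"
proof (cases w)
  case (Some z)
  have "(cmod z)\<^sup>2 + 1 > 0" using zero_le_power2[of "cmod z"] by linarith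
  then show ?thesis by (simp add: Some riem_Some_third field_simps)
qed (simp add: riem_def)

text \<open>Lets equality of sphere values be tested in a normed space, where differences and limits
  make sense.\<close>

lemma riem_eq_iff: "riem v = riem w \<longleftrightarrow> v = w"
proof
  assume eq: "riem v = riem w"
  then have "v \<noteq> None \<longleftrightarrow> w \<noteq> None" by (metis riem_third_less_1_iff)
  then show "v = w" using eq affine_chart_riem by (cases v; cases w; metis)
qed simp

section \<open>Identity and boundary uniqueness theorems for \<open>A_disc\<close>\<close>

lemma A_disc_continuous:
  assumes "h \<in> A_disc"
  shows "continuous_on (cball 0 1) (riem \<circ> h)"
proof -
  consider "\<forall>z\<in>cball 0 1. h z = None" | "continuous_on (cball 0 1) (riem \<circ> h)"
    using assms by (auto simp: A_disc_def)
  then show ?thesis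
  proof cases
    case 1
    then show ?thesis by (intro continuous_on_eq[OF continuous_on_const[of _ "riem None"]]) auto
  qed
qed

lemma A_disc_cases:
  assumes "h \<in> A_disc"
  obtains "\<And>z. z \<in> cball 0 1 \<Longrightarrow> h z = None"
  | "\<And>z. z \<in> ball 0 1 \<Longrightarrow> h z \<noteq> None" "(\<lambda>z. the (h z)) holomorphic_on ball 0 1"
  using assms unfolding A_disc_def by blast

text \<open>Agreement at one interior point forces both functions to be identically infinite or both
  to be finite in the open disc. In the latter case analytic continuation applies, and continuity
  reaches the boundary.\<close>

lemma A_disc_identity:
  assumes h: "h\<^sub>1 \<in> A_disc" "h\<^sub>2 \<in> A_disc"
    and U: "open U" "U \<noteq> {}" "U \<subseteq> ball 0 1" "\<And>z. z \<in> U \<Longrightarrow> h\<^sub>1 z = h\<^sub>2 z"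
    and w: "w \<in> cball 0 1"
  shows "h\<^sub>1 w = h\<^sub>2 w"
proof -
  obtain u where u: "u \<in> U" "u \<in> ball 0 1" "u \<in> cball 0 1"
    using U ball_subset_cball by blast
  have agree: "h\<^sub>1 z = h\<^sub>2 z" if z: "z \<in> ball 0 1" for z
    using h(1)
  proof (cases rule: A_disc_cases)
    case 1
    then have "h\<^sub>2 u = None" using U(4) u by metis
    have "z \<in> cball 0 1" using z by auto
    show ?thesis using h(2)
    proof (cases rule: A_disc_cases)
      case 2
      then show ?thesis using \<open>h\<^sub>2 u = None\<close> u by blast
    qed (use 1 \<open>z \<in> cball 0 1\<close> in simp)
  next
    case h1: 2
    show ?thesis using h(2)
    proof (cases rule: A_disc_cases)
      case 1
      then show ?thesis using h1(1) U(4) u by metis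
    next
      case 2
      have "the (h\<^sub>1 z) = the (h\<^sub>2 z)"
        by (rule analytic_continuation_open[OF U(1) open_ball U(2) connected_ball U(3) h1(2) 2(2)])
          (use U(4) z in auto)
      then show ?thesis using h1(1) 2(1) z by (metis option.expand)
    qed
  qed
  have "riem (h\<^sub>1 w) - riem (h\<^sub>2 w) = 0"
  proof (rule continuous_constant_on_closure[where S = "ball 0 1" and f = "\<lambda>w. riem (h\<^sub>1 w) - riem (h\<^sub>2 w)"])
    show "continuous_on (closure (ball 0 1)) (\<lambda>w. riem (h\<^sub>1 w) - riem (h\<^sub>2 w))"
      using A_disc_continuous[OF h(1)] A_disc_continuous[OF h(2)]
      by (auto simp: o_def intro!: continuous_intros)
  qed (use agree w in auto)
  then show ?thesis by (simp add: riem_eq_iff)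
qed

text \<open>Both functions take the same value at \<open>cis t\<^sub>0\<close>, so near that point
  both lie in one chart domain, and \<open>local_boundary_uniqueness\<close> applies to the
  difference of their chart expressions. The chart is abstract so that finite and infinite values
  share one proof.\<close>

lemma A_disc_agreement_locally_negligible:
  fixes chart :: "real \<times> real \<times> real \<Rightarrow> complex"
  assumes h: "h\<^sub>1 \<in> A_disc" "h\<^sub>2 \<in> A_disc" and w: "w \<in> cball 0 1" "h\<^sub>1 w \<noteq> h\<^sub>2 w"
    and S: "closed S" "\<And>t. t \<in> S \<Longrightarrow> h\<^sub>1 (cis t) = h\<^sub>2 (cis t)"
    and t\<^sub>0: "t\<^sub>0 \<in> S" "riem (h\<^sub>1 (cis t\<^sub>0)) \<in> V"
    and chart: "open V" "continuous_on V chart" "inj_on (chart \<circ> riem) (riem -` V)"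
    and hol: "\<And>h U. h \<in> A_disc \<Longrightarrow> U \<subseteq> ball 0 1 \<Longrightarrow> (\<And>z. z \<in> U \<Longrightarrow> riem (h z) \<in> V) \<Longrightarrow>
      (\<lambda>z. chart (riem (h z))) holomorphic_on U"
  obtains \<delta> where "0 < \<delta>" "negligible (S \<inter> {t\<^sub>0 - \<delta>..t\<^sub>0 + \<delta>})"
proof -
  have cis_in: "cis t \<in> cball 0 1" for t by simp
  have lim: "((\<lambda>z. riem (h z)) \<longlongrightarrow> riem (h z)) (at z within cball 0 1)"
    if "h \<in> A_disc" "z \<in> cball 0 1" for h z
    using A_disc_continuous[OF that(1)] that(2) by (simp add: continuous_on_def)
  have chart_lim: "((\<lambda>z. chart (riem (h z))) \<longlongrightarrow> chart (riem (h z))) (at z within cball 0 1)"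
    if "h \<in> A_disc" "z \<in> cball 0 1" "riem (h z) \<in> V" for h z
    using continuous_on_tendsto_compose[OF chart(2) lim[OF that(1,2)] that(3)]
      topological_tendstoD[OF lim[OF that(1,2)] chart(1) that(3)] by blast
  have near: "\<exists>r>0. \<forall>z\<in>cball 0 1 \<inter> ball (cis t\<^sub>0) r. riem (h z) \<in> V \<and>
      cmod (chart (riem (h z)) - chart (riem (h (cis t\<^sub>0)))) < 1"
    if "h \<in> A_disc" "riem (h (cis t\<^sub>0)) \<in> V" for h
  proof -
    have "eventually (\<lambda>z. riem (h z) \<in> V \<and> dist (chart (riem (h z))) (chart (riem (h (cis t\<^sub>0)))) < 1)
        (at (cis t\<^sub>0) within cball 0 1)"
      using topological_tendstoD[OF lim[OF that(1) cis_in] chart(1) that(2)]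
        tendstoD[OF chart_lim[OF that(1) cis_in that(2)] zero_less_one]
      by (rule eventually_conj)
    then obtain r where "r > 0" "\<forall>z\<in>cball 0 1. z \<noteq> cis t\<^sub>0 \<and> dist z (cis t\<^sub>0) < r \<longrightarrow>
        riem (h z) \<in> V \<and> dist (chart (riem (h z))) (chart (riem (h (cis t\<^sub>0)))) < 1"
      unfolding eventually_at by blast
    then show ?thesis using that(2)
      by (intro exI[of _ r]) (metis IntE dist_commute dist_norm mem_ball dist_self zero_less_one)
  qed
  have eq0: "h\<^sub>2 (cis t\<^sub>0) = h\<^sub>1 (cis t\<^sub>0)" using S(2) t\<^sub>0(1) by simp
  obtain r\<^sub>1 where r1: "r\<^sub>1 > 0" "\<And>z. z \<in> cball 0 1 \<inter> ball (cis t\<^sub>0) r\<^sub>1 \<Longrightarrow> riem (h\<^sub>1 z) \<in> V \<and>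
      cmod (chart (riem (h\<^sub>1 z)) - chart (riem (h\<^sub>1 (cis t\<^sub>0)))) < 1"
    using near[OF h(1) t\<^sub>0(2)] by blast
  obtain r\<^sub>2 where r2: "r\<^sub>2 > 0" "\<And>z. z \<in> cball 0 1 \<inter> ball (cis t\<^sub>0) r\<^sub>2 \<Longrightarrow> riem (h\<^sub>2 z) \<in> V \<and>
      cmod (chart (riem (h\<^sub>2 z)) - chart (riem (h\<^sub>1 (cis t\<^sub>0)))) < 1"
    using near[OF h(2)] t\<^sub>0(2) unfolding eq0 by blast
  define r where "r = min r\<^sub>1 r\<^sub>2"
  define \<Omega> where "\<Omega> = ball 0 1 \<inter> ball (cis t\<^sub>0) r"
  have \<Omega>: "z \<in> cball 0 1 \<inter> ball (cis t\<^sub>0) r\<^sub>1" "z \<in> cball 0 1 \<inter> ball (cis t\<^sub>0) r\<^sub>2" if "z \<in> \<Omega>" for z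
    using that by (auto simp: \<Omega>_def r_def)
  have "cis t\<^sub>0 \<in> closure (ball 0 1)" by simp
  moreover have "0 < r" using r1(1) r2(1) by (simp add: r_def)
  ultimately obtain y where "y \<in> ball 0 1" "dist y (cis t\<^sub>0) < r"
    unfolding closure_approachable by blast
  then have "\<Omega> \<noteq> {}" by (auto simp: \<Omega>_def dist_commute)
  \<comment> \<open>The functions differ at \<open>w\<close>, possibly far away; the identity
    theorem carries this into \<Omega>.\<close>
  have "\<exists>z\<in>\<Omega>. h\<^sub>1 z \<noteq> h\<^sub>2 z"
    using A_disc_identity[OF h _ \<open>\<Omega> \<noteq> {}\<close> _ _ w(1)] w(2) by (force simp: \<Omega>_def)
  then obtain z\<^sub>0 where z0: "z\<^sub>0 \<in> \<Omega>" "h\<^sub>1 z\<^sub>0 \<noteq> h\<^sub>2 z\<^sub>0" by blast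
  define G where "G z = chart (riem (h\<^sub>1 z)) - chart (riem (h\<^sub>2 z))" for z
  show ?thesis
  proof (rule local_boundary_uniqueness[of r G t\<^sub>0 2 S z\<^sub>0, folded \<Omega>_def])
    show "0 < r" using r1(1) r2(1) by (simp add: r_def)
    have "\<Omega> \<subseteq> ball 0 1" by (simp add: \<Omega>_def)
    then show "G holomorphic_on \<Omega>"
      unfolding G_def using r1(2)[OF \<Omega>(1)] r2(2)[OF \<Omega>(2)]
      by (intro holomorphic_on_diff hol h) auto
    \<comment> \<open>Each chart value is within 1 of the common value at
      \<open>cis t\<^sub>0\<close>.\<close>
    show "cmod (G z) \<le> 2" if "z \<in> \<Omega>" for z
      using r1(2)[OF \<Omega>(1)[OF that]] r2(2)[OF \<Omega>(2)[OF that]]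
        norm_triangle_ineq4[of "chart (riem (h\<^sub>1 z)) - chart (riem (h\<^sub>1 (cis t\<^sub>0)))"
          "chart (riem (h\<^sub>2 z)) - chart (riem (h\<^sub>1 (cis t\<^sub>0)))"]
      by (simp add: G_def)
    show "(G \<longlongrightarrow> 0) (at (cis t) within \<Omega>)" if t: "t \<in> S" "cis t \<in> ball (cis t\<^sub>0) r" for t
    proof -
      have "riem (h\<^sub>1 (cis t)) \<in> V" "riem (h\<^sub>2 (cis t)) \<in> V"
        using r1(2)[of "cis t"] S(2)[OF t(1)] t(2) by (auto simp: r_def)
      then have "(G \<longlongrightarrow> chart (riem (h\<^sub>1 (cis t))) - chart (riem (h\<^sub>2 (cis t)))) (at (cis t) within cball 0 1)"
        unfolding G_def by (intro tendsto_diff chart_lim h cis_in)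
      moreover have "\<Omega> \<subseteq> cball 0 1" by (auto simp: \<Omega>_def)
      ultimately show ?thesis
        using tendsto_within_subset S(2)[OF t(1)] by fastforce
    qed
    show "G z\<^sub>0 \<noteq> 0"
      using inj_onD[OF chart(3), of "h\<^sub>1 z\<^sub>0" "h\<^sub>2 z\<^sub>0"] z0 r1(2)[OF \<Omega>(1)] r2(2)[OF \<Omega>(2)]
      by (auto simp: G_def)
  qed (use S(1) z0 that in auto)
qed

text \<open>The agreement set \<open>S\<close> is closed and null near each of its points;
  compactness of its part in one period leaves finitely many null pieces.\<close>

lemma A_disc_agreement_negligible:
  assumes h: "h\<^sub>1 \<in> A_disc" "h\<^sub>2 \<in> A_disc" and w: "w \<in> cball 0 1" "h\<^sub>1 w \<noteq> h\<^sub>2 w"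
  shows "negligible {t \<in> {0..2*pi}. h\<^sub>1 (cis t) = h\<^sub>2 (cis t)}"
proof -
  define S where "S = {t. h\<^sub>1 (cis t) = h\<^sub>2 (cis t)}"
  have "continuous_on UNIV (\<lambda>t. riem (h (cis t)))" if "h \<in> A_disc" for h
    using continuous_on_compose2[OF A_disc_continuous[OF that, unfolded o_def] continuous_on_cis[OF continuous_on_id], of UNIV]
    by (simp add: image_subset_iff)
  from closed_Collect_eq[OF this[OF h(1)] this[OF h(2)]] have S: "closed S"
    by (simp add: S_def riem_eq_iff)
  \<comment> \<open>The value at \<open>cis t\<close> decides the chart:
    \<open>inverse_chart\<close> at infinity, \<open>affine_chart\<close> at finite values.\<close>
  have "\<exists>\<delta>>0. negligible (S \<inter> {t - \<delta>..t + \<delta>})" if "t \<in> S" for t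
  proof (cases "h\<^sub>1 (cis t)")
    case None
    show ?thesis
    proof (rule A_disc_agreement_locally_negligible[OF h w S _ that])
      show "riem (h\<^sub>1 (cis t)) \<in> {p. -1 < snd (snd p)}" by (simp add: None riem_def)
      show "open {p :: real \<times> real \<times> real. -1 < snd (snd p)}"
        by (intro open_Collect_less continuous_intros)
      show "continuous_on {p. -1 < snd (snd p)} inverse_chart"
        unfolding inverse_chart_def Complex_eq
        by (intro continuous_intros ballI, subst of_real_eq_0_iff) auto
      have "inverse_chart (riem v) \<noteq> 0" if "v \<noteq> Some 0" "v \<noteq> None" for v
        using that by (cases v) (auto simp: inverse_chart_riem)
      then show "inj_on (inverse_chart \<circ> riem) (riem -` {p. -1 < snd (snd p)})"
        by (intro inj_onI)
          (auto simp: riem_third_greater_minus_1_iff inverse_chart_riem inverse_chart_infinity,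
            metis inverse_chart_infinity inverse_chart_riem inverse_eq_iff_eq option.exhaust)
      fix h and U :: "complex set"
      assume hU: "h \<in> A_disc" "U \<subseteq> ball 0 1" "\<And>z. z \<in> U \<Longrightarrow> riem (h z) \<in> {p. -1 < snd (snd p)}"
      show "(\<lambda>z. inverse_chart (riem (h z))) holomorphic_on U"
        using hU(1)
      proof (cases rule: A_disc_cases)
        case 1
        moreover have "U \<subseteq> cball 0 1" using hU(2) by auto
        ultimately have "inverse_chart (riem (h z)) = 0" if "z \<in> U" for z
          using that by (auto simp: inverse_chart_infinity)
        then show ?thesis by (simp cong: holomorphic_cong)
      next
        case 2
        have some: "h z = Some (the (h z))" "the (h z) \<noteq> 0" if "z \<in> U" for z
        proof -
          have "h z \<noteq> None" "h z \<noteq> Some 0"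
            using 2(1) hU(2) hU(3)[OF that] that by (auto simp: riem_third_greater_minus_1_iff)
          then show "h z = Some (the (h z))" "the (h z) \<noteq> 0" by auto
        qed
        then have "inverse_chart (riem (h z)) = inverse (the (h z))" if "z \<in> U" for z
          using that inverse_chart_riem by metis
        moreover have "(\<lambda>z. inverse (the (h z))) holomorphic_on U"
          using some(2) 2(2) hU(2) by (intro holomorphic_on_inverse) (auto intro: holomorphic_on_subset)
        ultimately show ?thesis by (simp cong: holomorphic_cong)
      qed
    qed (auto simp: S_def)
  next
    case (Some a)
    show ?thesis
    proof (rule A_disc_agreement_locally_negligible[OF h w S _ that])
      show "riem (h\<^sub>1 (cis t)) \<in> {p. snd (snd p) < 1}" by (simp add: Some riem_third_less_1_iff)
      show "open {p :: real \<times> real \<times> real. snd (snd p) < 1}"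
        by (intro open_Collect_less continuous_intros)
      show "continuous_on {p. snd (snd p) < 1} affine_chart"
        unfolding affine_chart_def Complex_eq
        by (intro continuous_intros ballI, subst of_real_eq_0_iff) auto
      show "inj_on (affine_chart \<circ> riem) (riem -` {p. snd (snd p) < 1})"
        by (intro inj_onI) (auto simp: riem_third_less_1_iff affine_chart_riem)
      fix h and U :: "complex set"
      assume hU: "h \<in> A_disc" "U \<subseteq> ball 0 1" "\<And>z. z \<in> U \<Longrightarrow> riem (h z) \<in> {p. snd (snd p) < 1}"
      have "affine_chart (riem (h z)) = the (h z)" if "z \<in> U" for z
        using hU(3)[OF that] by (auto simp: riem_third_less_1_iff affine_chart_riem)
      moreover have "(\<lambda>z. the (h z)) holomorphic_on U"
        using hU(1)
      proof (cases rule: A_disc_cases)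
        \<comment> \<open>A function that is identically infinite never meets the domain of the
          affine chart, so \<open>U\<close> is empty.\<close>
        case 1
        moreover have "U \<subseteq> cball 0 1" using hU(2) by auto
        moreover have "h z \<noteq> None" if "z \<in> U" for z
          using hU(3)[OF that] riem_third_less_1_iff by simp
        ultimately have "U = {}" by blast
        then show ?thesis by (simp add: holomorphic_on_def)
      qed (use hU(2) holomorphic_on_subset in blast)
      ultimately show "(\<lambda>z. affine_chart (riem (h z))) holomorphic_on U" by (simp cong: holomorphic_cong)
    qed (auto simp: S_def)
  qed
  then obtain \<delta> where \<delta>: "\<And>t. t \<in> S \<Longrightarrow> 0 < \<delta> t" "\<And>t. t \<in> S \<Longrightarrow> negligible (S \<inter> {t - \<delta> t..t + \<delta> t})"
    by metis
  have "compact (S \<inter> {0..2*pi})" using S by (simp add: closed_Int_compact)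
  moreover have "S \<inter> {0..2*pi} \<subseteq> (\<Union>t\<in>S. ball t (\<delta> t))" using \<delta>(1) by force
  ultimately obtain D where D: "D \<subseteq> S" "finite D" "S \<inter> {0..2*pi} \<subseteq> (\<Union>t\<in>D. ball t (\<delta> t))"
    by (elim compactE_image) auto
  have "negligible (\<Union>t\<in>D. S \<inter> {t - \<delta> t..t + \<delta> t})"
    using D(1,2) \<delta>(2) by (intro negligible_Union) auto
  moreover have "{t \<in> {0..2*pi}. h\<^sub>1 (cis t) = h\<^sub>2 (cis t)} \<subseteq> (\<Union>t\<in>D. S \<inter> {t - \<delta> t..t + \<delta> t})"
  proof
    fix t assume "t \<in> {t \<in> {0..2*pi}. h\<^sub>1 (cis t) = h\<^sub>2 (cis t)}"
    then have t: "t \<in> S \<inter> {0..2*pi}" by (simp add: S_def)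
    then obtain s where "s \<in> D" "t \<in> ball s (\<delta> s)" using D(3) by blast
    then have "t \<in> S \<inter> {s - \<delta> s..s + \<delta> s}"
      using t by (auto simp: dist_real_def abs_if split: if_splits)
    then show "t \<in> (\<Union>t\<in>D. S \<inter> {t - \<delta> t..t + \<delta> t})" using \<open>s \<in> D\<close> by blast
  qed
  ultimately show ?thesis by (rule negligible_subset)
qed

subsection \<open>Functions on the polydisc\<close>

text \<open>
  The sample space of \<^const>\<open>torus_measure\<close> consists of all complex families, and for uncountable
  \<open>I\<close> the torus is not a measurable subset of it; hence points are retracted onto the torus instead.
\<close>

definition radial :: "complex \<Rightarrow> complex" where
  "radial w = (if w = 0 then 1 else w / of_real (cmod w))"

lemma norm_radial [simp]: "cmod (radial w) = 1"
  by (simp add: radial_def norm_divide)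

lemma radial_unit: "cmod w = 1 \<Longrightarrow> radial w = w"
  by (auto simp: radial_def)

lemma borel_measurable_radial [measurable]: "radial \<in> borel_measurable borel"
  unfolding radial_def by measurable

lemma sets_circle_measure [measurable_cong, simp]: "sets circle_measure = sets borel"
  by (simp add: circle_measure_def)

lemma space_circle_measure [simp]: "space circle_measure = UNIV"
  by (simp add: circle_measure_def)

lemma prob_space_circle_measure: "prob_space circle_measure"
proof -
  interpret prob_space "uniform_measure lborel {0..2*pi}"
    by (rule prob_space_uniform_measure) auto
  have "cis \<in> borel_measurable borel"
    by (intro borel_measurable_continuous_onI continuous_intros)
  then show ?thesis
    unfolding circle_measure_def by (intro prob_space_distr) simp
qed

text \<open>The agreement set on the circle is compact, so its preimage under \<open>cis\<close> is
  Borel and nullity for the completed Lebesgue measure passes to \<open>lborel\<close>. On the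
  circle \<open>radial\<close> is the identity.\<close>

lemma A_disc_AE_neq:
  assumes h: "h\<^sub>1 \<in> A_disc" "h\<^sub>2 \<in> A_disc" and w: "w \<in> cball 0 1" "h\<^sub>1 w \<noteq> h\<^sub>2 w"
  shows "AE v in circle_measure. h\<^sub>1 (radial v) \<noteq> h\<^sub>2 (radial v)"
proof -
  define S where "S = {v \<in> sphere 0 1. h\<^sub>1 v = h\<^sub>2 v}"
  have "continuous_on (sphere 0 1) (\<lambda>v. riem (h v))" if "h \<in> A_disc" for h
    using continuous_on_subset[OF A_disc_continuous[OF that], of "sphere 0 1"] by (auto simp: o_def)
  from continuous_closedin_preimage_constant[OF continuous_on_diff[OF this[OF h(1)] this[OF h(2)]], of 0]
  have "closedin (top_of_set (sphere 0 1)) S"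
    by (simp add: S_def riem_eq_iff)
  then have S: "closed S" using closedin_closed_trans closed_sphere by blast
  have cis[measurable]: "cis \<in> borel_measurable borel"
    by (intro borel_measurable_continuous_onI continuous_intros)
  have set: "{v. h\<^sub>1 (radial v) \<noteq> h\<^sub>2 (radial v)} = radial -` (- S)"
    by (auto simp: S_def)
  have N: "{t \<in> {0..2*pi}. h\<^sub>1 (cis t) = h\<^sub>2 (cis t)} = {0..2*pi} \<inter> cis -` S"
    by (auto simp: S_def)
  have "{0..2*pi} \<inter> cis -` S \<in> sets lborel"
    using measurable_sets[OF cis borel_closed[OF S]] by simp
  moreover have "{0..2*pi} \<inter> cis -` S \<in> null_sets lebesgue"
    using A_disc_agreement_negligible[OF h w] unfolding N negligible_iff_null_sets .
  ultimately have "{0..2*pi} \<inter> cis -` S \<in> null_sets lborel"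
    using null_sets_completion_iff by blast
  from AE_not_in[OF this] have "AE t in lborel. t \<in> {0..2*pi} \<longrightarrow> h\<^sub>1 (radial (cis t)) \<noteq> h\<^sub>2 (radial (cis t))"
    by eventually_elim (auto simp: S_def radial_unit)
  then have "AE t in uniform_measure lborel {0..2*pi}. h\<^sub>1 (radial (cis t)) \<noteq> h\<^sub>2 (radial (cis t))"
    by (rule AE_uniform_measureI[rotated]) simp
  moreover have "radial -` (- S) \<in> sets borel"
    using measurable_sets[OF borel_measurable_radial borel_open[OF open_Compl[OF S]]] by simp
  ultimately show ?thesis
    unfolding circle_measure_def by (subst AE_distr_iff) (auto simp: set)
qed

text \<open>Open sets of an uncountable product need not lie in the product sigma-algebra, but the
  set where a continuous function is nonzero does: it exhausts itself by the compact sets where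
  \<open>\<bar>d\<bar>\<close> is at least 1/(n+1), each covered by finitely many boxes on which
  \<open>d\<close> does not vanish.\<close>

lemma sets_torus_neq_0:
  fixes d :: "('i \<Rightarrow> complex) \<Rightarrow> real"
  assumes d: "continuous_map (product_topology (\<lambda>_. top_of_set (sphere 0 1)) I) euclideanreal d"
  shows "{y \<in> space (torus_measure I). d (\<lambda>i\<in>I. radial (y i)) \<noteq> 0} \<in> sets (torus_measure I)"
proof -
  define X where "X = product_topology (\<lambda>_::'i. top_of_set (sphere (0::complex) 1)) I"
  define R where "R y = (\<lambda>i\<in>I. radial (y i))" for y :: "'i \<Rightarrow> complex"
  have topX: "topspace X = PiE I (\<lambda>_. sphere 0 1)" by (simp add: X_def)
  have R: "R y \<in> topspace X" for y by (auto simp: topX R_def)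
  \<comment> \<open>Compactness makes finitely many boxes suffice, although \<open>I\<close> may be uncountable.\<close>
  define basic where "basic B \<longleftrightarrow> openin X B \<and> {y \<in> space (torus_measure I). R y \<in> B} \<in> sets (torus_measure I)" for B
  have basic_nbhd: "\<exists>B. basic B \<and> z \<in> B \<and> B \<subseteq> W" if W: "openin X W" "z \<in> W" for z W
  proof -
    obtain U where U: "finite {i \<in> I. U i \<noteq> sphere 0 1}" "\<And>i. i \<in> I \<Longrightarrow> openin (top_of_set (sphere 0 1)) (U i)"
      "z \<in> PiE I U" "PiE I U \<subseteq> W"
      using W unfolding X_def openin_product_topology_alt by auto
    have "\<exists>V. open V \<and> U i = sphere 0 1 \<inter> V" if "i \<in> I" for i
      using U(2)[OF that] by (auto simp: openin_open)
    then obtain V where V: "\<And>i. i \<in> I \<Longrightarrow> open (V i)" "\<And>i. i \<in> I \<Longrightarrow> U i = sphere 0 1 \<inter> V i"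
      by metis
    \<comment> \<open>Since \<open>radial\<close> takes values in the circle, only the finitely many
      coordinates in \<open>J\<close> restrict \<open>y\<close>.\<close>
    define J where "J = {i \<in> I. U i \<noteq> sphere 0 1}"
    have "R y \<in> PiE I U \<longleftrightarrow> (\<forall>i\<in>J. radial (y i) \<in> V i)" for y
    proof -
      have "R y \<in> PiE I U \<longleftrightarrow> (\<forall>i\<in>I. radial (y i) \<in> U i)" by (auto simp: R_def PiE_iff)
      also have "\<dots> \<longleftrightarrow> (\<forall>i\<in>J. radial (y i) \<in> U i)" by (auto simp: J_def)
      also have "\<dots> \<longleftrightarrow> (\<forall>i\<in>J. radial (y i) \<in> V i)" using V(2) by (auto simp: J_def)
      finally show ?thesis .
    qed
    moreover have "{y \<in> space (torus_measure I). \<forall>i\<in>J. radial (y i) \<in> V i} \<in> sets (torus_measure I)"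
    proof (intro sets.sets_Collect_finite_All)
      fix i assume "i \<in> J"
      then have i: "i \<in> I" by (simp add: J_def)
      then have "(\<lambda>y. radial (y i)) \<in> borel_measurable (torus_measure I)"
        unfolding torus_measure_def by measurable
      from measurable_sets[OF this borel_open[OF V(1)[OF i]]]
      show "{y \<in> space (torus_measure I). radial (y i) \<in> V i} \<in> sets (torus_measure I)"
        by (simp add: vimage_def Int_def conj_commute)
    qed (use U(1) J_def in simp)
    moreover have "openin X (PiE I U)"
      unfolding X_def using U(1,2) by (simp add: openin_PiE_gen)
    ultimately have "basic (PiE I U)" by (simp add: basic_def)
    then show ?thesis using U by blast
  qed
  define W where "W = {z \<in> topspace X. d z \<noteq> 0}"
  have W: "openin X W"
    unfolding W_def using openin_continuous_map_preimage[OF d[folded X_def], of "- {0}"] by (simp add: open_Compl)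
  have compact: "compact_space X"
    unfolding X_def by (simp add: compact_space_product_topology compact_space_subtopology)
  have cover: "\<exists>\<B>. finite \<B> \<and> (\<forall>B\<in>\<B>. basic B \<and> B \<subseteq> W) \<and> {z \<in> topspace X. 1 / real (Suc n) \<le> \<bar>d z\<bar>} \<subseteq> \<Union>\<B>" for n
  proof -
    have "closedin X {z \<in> topspace X. d z \<in> {x. 1 / real (Suc n) \<le> \<bar>x\<bar>}}"
      by (intro closedin_continuous_map_preimage[OF d[folded X_def]])
        (auto intro!: closed_Collect_le continuous_intros)
    then have "compactin X {z \<in> topspace X. 1 / real (Suc n) \<le> \<bar>d z\<bar>}"
      using closedin_compact_space[OF compact] by simp
    moreover have "{z \<in> topspace X. 1 / real (Suc n) \<le> \<bar>d z\<bar>} \<subseteq> W"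
    proof -
      have "1 / real (Suc n) > 0" by simp
      then show ?thesis unfolding W_def by force
    qed
    then have "{z \<in> topspace X. 1 / real (Suc n) \<le> \<bar>d z\<bar>} \<subseteq> \<Union>{B. basic B \<and> B \<subseteq> W}"
      using basic_nbhd[OF W] by blast
    ultimately obtain \<B> where "finite \<B>" "\<B> \<subseteq> {B. basic B \<and> B \<subseteq> W}"
      "{z \<in> topspace X. 1 / real (Suc n) \<le> \<bar>d z\<bar>} \<subseteq> \<Union>\<B>"
      unfolding compactin_def basic_def by (metis (no_types, lifting) mem_Collect_eq)
    then show ?thesis by blast
  qed
  then obtain \<B> where \<B>: "\<And>n. finite (\<B> n)" "\<And>n B. B \<in> \<B> n \<Longrightarrow> basic B \<and> B \<subseteq> W"
    "\<And>n. {z \<in> topspace X. 1 / real (Suc n) \<le> \<bar>d z\<bar>} \<subseteq> \<Union>(\<B> n)"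
    by metis
  have "{y \<in> space (torus_measure I). d (R y) \<noteq> 0} =
    (\<Union>n. \<Union>B\<in>\<B> n. {y \<in> space (torus_measure I). R y \<in> B})"
  proof (intro equalityI subsetI)
    fix y assume y: "y \<in> {y \<in> space (torus_measure I). d (R y) \<noteq> 0}"
    then obtain n where "inverse (real (Suc n)) < \<bar>d (R y)\<bar>"
      using reals_Archimedean[of "\<bar>d (R y)\<bar>"] by auto
    then have "R y \<in> \<Union>(\<B> n)" using \<B>(3)[of n] R[of y] by (auto simp: inverse_eq_divide)
    then show "y \<in> (\<Union>n. \<Union>B\<in>\<B> n. {y \<in> space (torus_measure I). R y \<in> B})" using y by blast
  next
    fix y assume "y \<in> (\<Union>n. \<Union>B\<in>\<B> n. {y \<in> space (torus_measure I). R y \<in> B})"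
    then show "y \<in> {y \<in> space (torus_measure I). d (R y) \<noteq> 0}"
      using \<B>(2) by (auto simp: W_def)
  qed
  also have "\<dots> \<in> sets (torus_measure I)"
    using \<B>(1,2) by (intro sets.countable_UN sets.finite_UN image_subsetI) (auto simp: basic_def)
  finally show ?thesis unfolding R_def .
qed

section \<open>Random points with finitely many prescribed coordinates\<close>

definition splice_radial :: "'i set \<Rightarrow> 'i set \<Rightarrow> ('i \<Rightarrow> complex) \<Rightarrow> ('i \<Rightarrow> complex) \<Rightarrow> 'i \<Rightarrow> complex" where
  "splice_radial I F x y = (\<lambda>i\<in>I. if i \<in> F then x i else radial (y i))"

lemma splice_radial_in_polydisc:
  assumes "x \<in> PiE I (\<lambda>_. cball 0 1)"
  shows "splice_radial I F x y \<in> PiE I (\<lambda>_. cball 0 1)"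
  using assms by (auto simp: splice_radial_def PiE_iff)

lemma continuous_map_A_polydisc_diff:
  assumes "f \<in> A_polydisc I" "g \<in> A_polydisc I"
  shows "continuous_map (product_topology (\<lambda>_. top_of_set (cball 0 1)) I) euclideanreal
    (\<lambda>z. norm (riem (f z) - riem (g z)))"
  using assms by (intro continuous_map_norm continuous_map_diff) (auto simp: A_polydisc_def o_def)

text \<open>Freezing the coordinates in \<open>F\<close> is a continuous map \<open>c\<close> from
  the torus to the polydisc, so disagreement is the nonvanishing of a continuous real function on
  the torus.\<close>

lemma sets_splice_radial_neq:
  assumes f: "f \<in> A_polydisc I" and g: "g \<in> A_polydisc I" and x: "x \<in> PiE I (\<lambda>_. cball 0 1)"
  shows "{y \<in> space (torus_measure I). f (splice_radial I F x y) \<noteq> g (splice_radial I F x y)}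
    \<in> sets (torus_measure I)"
proof -
  define c where "c z = (\<lambda>i\<in>I. if i \<in> F then x i else z i)" for z :: "'a \<Rightarrow> complex"
  have "continuous_map (product_topology (\<lambda>_. top_of_set (sphere 0 1)) I)
      (product_topology (\<lambda>_. top_of_set (cball 0 1)) I) c"
  proof (subst continuous_map_componentwise, intro conjI ballI)
    fix i assume i: "i \<in> I"
    show "continuous_map (product_topology (\<lambda>_. top_of_set (sphere 0 1)) I) (top_of_set (cball 0 1)) (\<lambda>z. c z i)"
    proof (cases "i \<in> F")
      case True
      then show ?thesis using i x by (auto simp: c_def PiE_iff)
    next
      case False
      have "continuous_map (product_topology (\<lambda>_. top_of_set (sphere 0 1)) I) (top_of_set (cball 0 1)) (\<lambda>z. z i)"
        using continuous_map_product_projection[OF i, of "\<lambda>_. top_of_set (sphere 0 1)"]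
        by (auto simp: continuous_map_in_subtopology PiE_iff i)
      then show ?thesis using i False by (simp add: c_def)
    qed
  qed (auto simp: c_def)
  from sets_torus_neq_0[OF continuous_map_compose[OF this continuous_map_A_polydisc_diff[OF f g]]]
  have "{y \<in> space (torus_measure I).
    norm (riem (f (c (\<lambda>i\<in>I. radial (y i)))) - riem (g (c (\<lambda>i\<in>I. radial (y i))))) \<noteq> 0} \<in> sets (torus_measure I)"
    by (simp add: o_def)
  moreover have "c (\<lambda>i\<in>I. radial (y i)) = splice_radial I F x y" for y
    by (auto simp: c_def splice_radial_def)
  ultimately show ?thesis by (simp add: riem_eq_iff)
qed

text \<open>Contrapositive of the step from \<open>F\<close> to \<open>insert j F\<close>. For
  almost all remaining coordinates the slices of \<open>f\<close> and \<open>g\<close> in direction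
  \<open>j\<close> differ at \<open>x j\<close>, hence almost everywhere on the circle by
  \<open>A_disc_AE_neq\<close>; Fubini reassembles the product.\<close>

lemma AE_splice_radial_remove:
  assumes f: "f \<in> A_polydisc I" and g: "g \<in> A_polydisc I" and x: "x \<in> PiE I (\<lambda>_. cball 0 1)"
    and j: "j \<in> I" "j \<notin> F"
    and AE: "AE y in torus_measure I. f (splice_radial I (insert j F) x y) \<noteq> g (splice_radial I (insert j F) x y)"
  shows "AE y in torus_measure I. f (splice_radial I F x y) \<noteq> g (splice_radial I F x y)"
proof -
  define J where "J = I - {j}"
  have I: "I = insert j J" using j by (auto simp: J_def)
  interpret C: prob_space circle_measure by (rule prob_space_circle_measure)
  interpret M: prob_space "torus_measure J"
    unfolding torus_measure_def by (intro prob_space_PiM prob_space_circle_measure)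
  interpret pair_sigma_finite circle_measure "torus_measure J" ..
  define u where "u = (\<lambda>(w :: complex, Y :: 'a \<Rightarrow> complex). Y(j := w))"
  have distr: "torus_measure I = distr (circle_measure \<Otimes>\<^sub>M torus_measure J) (torus_measure I) u"
    unfolding torus_measure_def I u_def
    by (rule distr_pair_PiM_eq_PiM[symmetric]) (rule prob_space_circle_measure)+
  have u: "u \<in> measurable (circle_measure \<Otimes>\<^sub>M torus_measure J) (torus_measure I)"
    unfolding u_def torus_measure_def I by measurable
  have AE_u: "(AE p in circle_measure \<Otimes>\<^sub>M torus_measure J. f (splice_radial I F' x (u p)) \<noteq> g (splice_radial I F' x (u p)))
      \<longleftrightarrow> (AE y in torus_measure I. f (splice_radial I F' x y) \<noteq> g (splice_radial I F' x y))" for F'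
    using AE_distr_iff[OF u sets_splice_radial_neq[OF f g x], folded distr] by blast
  define Q where "Q w Y \<longleftrightarrow> f (splice_radial I F x (u (w, Y))) \<noteq> g (splice_radial I F x (u (w, Y)))" for w Y
  define b where "b Y = splice_radial I (insert j F) x Y" for Y
  \<comment> \<open>With coordinate \<open>j\<close> frozen the circle variable \<open>w\<close>
    drops out, so the hypothesis becomes a statement about \<open>Y\<close> alone.\<close>
  have "splice_radial I (insert j F) x (u (w, Y)) = b Y" for w Y
    by (auto simp: splice_radial_def u_def b_def)
  then have "AE w in circle_measure. AE Y in torus_measure J. f (b Y) \<noteq> g (b Y)"
    using AE_pair[OF AE_u[THEN iffD2, OF AE]] by simp
  then have "AE Y in torus_measure J. f (b Y) \<noteq> g (b Y)" by simp
  then have "AE Y in torus_measure J. AE w in circle_measure. Q w Y"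
  proof eventually_elim
    fix Y assume neq: "f (b Y) \<noteq> g (b Y)"
    have b: "b Y \<in> PiE I (\<lambda>_. cball 0 1)"
      unfolding b_def by (rule splice_radial_in_polydisc[OF x])
    have slice: "(\<lambda>w. f ((b Y)(j := w))) \<in> A_disc" "(\<lambda>w. g ((b Y)(j := w))) \<in> A_disc"
      using f g j b by (auto simp: A_polydisc_def)
    have "(b Y)(j := x j) = b Y" using j by (auto simp: b_def splice_radial_def)
    then have "AE w in circle_measure. f ((b Y)(j := radial w)) \<noteq> g ((b Y)(j := radial w))"
      using neq x j by (intro A_disc_AE_neq[OF slice, of "x j"]) (auto simp: PiE_iff)
    moreover have "splice_radial I F x (u (w, Y)) = (b Y)(j := radial w)" for w
      using j by (auto simp: splice_radial_def u_def b_def fun_eq_iff)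
    ultimately show "AE w in circle_measure. Q w Y"
      by (simp add: Q_def)
  qed
  moreover have Q_sets: "{p \<in> space (circle_measure \<Otimes>\<^sub>M torus_measure J). Q (fst p) (snd p)}
      \<in> sets (circle_measure \<Otimes>\<^sub>M torus_measure J)" (is "?A \<in> _")
  proof -
    have "?A = u -` {y \<in> space (torus_measure I). f (splice_radial I F x y) \<noteq> g (splice_radial I F x y)}
        \<inter> space (circle_measure \<Otimes>\<^sub>M torus_measure J)"
      using measurable_space[OF u] by (auto simp: Q_def)
    then show ?thesis using measurable_sets[OF u sets_splice_radial_neq[OF f g x]] by simp
  qed
  ultimately have "AE p in circle_measure \<Otimes>\<^sub>M torus_measure J. Q (fst p) (snd p)"
    using AE_pair_iff[OF Q_sets] AE_commute[OF Q_sets] by blast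
  then show ?thesis using AE_u by (simp add: Q_def)
qed

theorem theorem4p4:
  fixes I :: "'i set" and K :: "('i \<Rightarrow> complex) set"
    and f g :: "('i \<Rightarrow> complex) \<Rightarrow> complex option"
  assumes "I \<noteq> {}"
    and "compactin (product_topology (\<lambda>_. top_of_set (sphere 0 1)) I) K"
    and "torus_outer I K > 0"
    and "f \<in> A_polydisc I" and "g \<in> A_polydisc I"
    and "\<forall>z\<in>K. f z = g z"
  shows "\<forall>z\<in>PiE I (\<lambda>_. cball 0 1). f z = g z"
proof (rule ballI, rule ccontr)
  fix x :: "'i \<Rightarrow> complex" assume x: "x \<in> PiE I (\<lambda>_. cball 0 1)" and neq: "f x \<noteq> g x"
  note f = assms(4) and g = assms(5)
  let ?s = "splice_radial I"
  \<comment> \<open>Working with failure of almost sure disagreement, rather than with a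
    probability, makes the induction step a direct contraposition.\<close>
  have not_AE: "\<not> (AE y in torus_measure I. f (?s F x y) \<noteq> g (?s F x y))" if "finite F" "F \<subseteq> I" for F
    using that
  proof (induction F rule: finite_induct)
    case empty
    show ?case
    proof
      assume AE: "AE y in torus_measure I. f (?s {} x y) \<noteq> g (?s {} x y)"
      \<comment> \<open>\<open>N\<close> is a measurable set containing \<open>K\<close>; if it were
        null, the outer measure of \<open>K\<close> would vanish.\<close>
      define N where "N = {y \<in> space (torus_measure I). f (?s {} x y) = g (?s {} x y)}"
      have N: "N = space (torus_measure I) - {y \<in> space (torus_measure I). f (?s {} x y) \<noteq> g (?s {} x y)}"
        by (auto simp: N_def)
      have N_sets: "N \<in> sets (torus_measure I)"
        unfolding N by (intro sets.Diff sets.top sets_splice_radial_neq[OF f g x])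
      have "K \<subseteq> N"
      proof
        fix z assume z: "z \<in> K"
        then have "z \<in> PiE I (\<lambda>_. sphere 0 1)"
          using compactin_subset_topspace[OF assms(2)] by auto
        then have "?s {} x z = z" "z \<in> space (torus_measure I)"
          by (auto simp: splice_radial_def PiE_iff extensional_def radial_unit torus_measure_def space_PiM)
        then show "z \<in> N" using assms(6) z by (simp add: N_def)
      qed
      then have "torus_outer I K \<le> emeasure (torus_measure I) N"
        unfolding torus_outer_def using N_sets by (intro INF_lower) auto
      also have "\<dots> = 0"
        using AE AE_iff_measurable[OF N_sets, of "\<lambda>y. f (?s {} x y) \<noteq> g (?s {} x y)"] by (simp add: N_def)
      finally show False using assms(3) by simp
    qed
  next
    case (insert j F)
    then show ?case using AE_splice_radial_remove[OF f g x] by blast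
  qed
  define W where "W = {z \<in> PiE I (\<lambda>_. cball 0 1). norm (riem (f z) - riem (g z)) \<in> - {0}}"
  have "openin (product_topology (\<lambda>_. top_of_set (cball 0 1)) I) W"
    using openin_continuous_map_preimage[OF continuous_map_A_polydisc_diff[OF f g], of "- {0}"]
    by (simp add: W_def open_Compl)
  moreover have "x \<in> W" using x neq by (simp add: W_def riem_eq_iff)
  ultimately obtain U where U: "finite {i \<in> I. U i \<noteq> cball 0 1}" "x \<in> PiE I U" "PiE I U \<subseteq> W"
    unfolding openin_product_topology_alt by (auto dest!: bspec[where x = x])
  \<comment> \<open>Outside \<open>F\<close> the box allows the whole closed disc, so any point that
    agrees with \<open>x\<close> on \<open>F\<close> lies in it, in particular each spliced
    point.\<close>
  define F where "F = {i \<in> I. U i \<noteq> cball 0 1}"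
  have "\<not> (AE y in torus_measure I. f (?s F x y) \<noteq> g (?s F x y))"
    using U(1) by (intro not_AE) (auto simp: F_def)
  then obtain y where "f (?s F x y) = g (?s F x y)" 
    using AE_I2[of "torus_measure I" "\<lambda>y. f (?s F x y) \<noteq> g (?s F x y)"] by blast
  moreover have "?s F x y \<in> PiE I U"
    using U(2) by (auto simp: splice_radial_def PiE_iff F_def)
  ultimately show False using U(3) by (auto simp: W_def)
qed

end
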